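(* Let $\Lambda\in\mathcal H$ be an element of integral type and $g\in\mathcal H$ a group-like element. Then $\mathcal A_\Lambda$ admits a faithful $g$-cointegral if and only if ${}_\Lambda\mathcal V=S(\mathcal A_\Lambda)g$. In particular, if $\mathcal A_\Lambda$ admits a faithful non-zero $g$-cointegral, then (1) $(1\otimes\Lambda)\Delta(\Lambda)=S(\Lambda)g\otimes\Lambda$; (2) $L^{\mathcal A_\Lambda}_\varepsilon=R^{\mathcal A_\Lambda}_\varepsilon$ if and only if $\Lambda=S(\Lambda)g$.
   Context: $k$ is a field; $\mathcal H$ is a Hopf algebra over $k$ with comultiplication $\Delta$, counit $\varepsilon$, invertible antipode $S$, dual $\mathcal H'$. A group-like element is a non-zero $g$ with $\Delta(g)=g\otimes g$. For $\Lambda\in\mathcal H$, ${}_\Lambda\mathcal V=\{(\mathrm{id}\otimes\nu)\Delta(\Lambda):\nu\in\mathcal H'\}$. A non-zero $\Lambda$ is of integral type if $\Delta(\Lambda)(1\otimes\Lambda)=\Lambda\otimes\Lambda$, and $\mathcal A_\Lambda=\{a\in\mathcal H:\Delta(a)(1\otimes\Lambda)=b\otimes\Lambda\text{ for some }b\in\mathcal H\}$ (a finite-dimensional left coideal subalgebra). For a left coideal subalgebra $\mathcal A$, a $g$-cointegral on $\mathcal A$ is $\phi\in\mathcal A'$ with $(\mathrm{id}\otimes\phi)(\Delta(a))=\phi(a)g$ for all $a\in\mathcal A$; it is faithful if $\phi(ab)=0$ for all $b\in\mathcal A$ implies $a=0$. $L^{\mathcal A}_\varepsilon=\{x\in\mathcal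 A: ax=\varepsilon(a)x\ \forall a\in\mathcal A\}$, $R^{\mathcal A}_\varepsilon=\{x\in\mathcal A: xa=\varepsilon(a)x\ \forall a\in\mathcal A\}$. *)

theory Defs
  imports Main "HOL.Vector_Spaces"
begin

text \<open>
  A k-algebra H is modelled as a type 'h of class ring_1 together with a scalar
  multiplication sc :: 'k \<Rightarrow> 'h \<Rightarrow> 'h over a field 'k.
  Elements of H \<otimes> H are represented by finite formal sums, i.e. lists of pairs
  [(x1,y1),...,(xn,yn)] standing for x1\<otimes>y1 + ... + xn\<otimes>yn.  Two such
  representatives denote the same tensor iff they induce the same bilinear
  form on H' \<times> H' (H' = linear functionals on H); over a field the canonical
  map H\<otimes>H \<rightarrow> (H'\<otimes>H')^* is injective, so this is exactly equality in H\<otimes>H.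
\<close>

type_synonym 'h tens = "('h \<times> 'h) list"

definition dual_lin :: "('k::field \<Rightarrow> 'h::ring_1 \<Rightarrow> 'h) \<Rightarrow> ('h \<Rightarrow> 'k) \<Rightarrow> bool" where
  "dual_lin sc \<nu> \<longleftrightarrow> Vector_Spaces.linear sc (*) \<nu>"

definition pairing :: "'h tens \<Rightarrow> ('h \<Rightarrow> 'k::field) \<Rightarrow> ('h \<Rightarrow> 'k) \<Rightarrow> 'k" where
  "pairing t \<mu> \<nu> = sum_list (map (\<lambda>(x,y). \<mu> x * \<nu> y) t)"

definition tensor_eq :: "('k::field \<Rightarrow> 'h::ring_1 \<Rightarrow> 'h) \<Rightarrow> 'h tens \<Rightarrow> 'h tens \<Rightarrow> bool" where
  "tensor_eq sc t u \<longleftrightarrow>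
     (\<forall>\<mu> \<nu>. dual_lin sc \<mu> \<and> dual_lin sc \<nu> \<longrightarrow> pairing t \<mu> \<nu> = pairing u \<mu> \<nu>)"

definition tmul :: "'h::ring_1 tens \<Rightarrow> 'h tens \<Rightarrow> 'h tens" where
  "tmul t u = concat (map (\<lambda>(x,y). map (\<lambda>(x',y'). (x * x', y * y')) u) t)"

definition slice_right :: "('k::field \<Rightarrow> 'h::ring_1 \<Rightarrow> 'h) \<Rightarrow> ('h \<Rightarrow> 'k) \<Rightarrow> 'h tens \<Rightarrow> 'h" where
  "slice_right sc \<nu> t = sum_list (map (\<lambda>(x,y). sc (\<nu> y) x) t)"

definition hopf_algebra ::
  "('k::field \<Rightarrow> 'h::ring_1 \<Rightarrow> 'h) \<Rightarrow> ('h \<Rightarrow> 'h tens) \<Rightarrow> ('h \<Rightarrow> 'k) \<Rightarrow> ('h \<Rightarrow> 'h) \<Rightarrow> bool" where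
  "hopf_algebra sc D e S \<longleftrightarrow>
     vector_space sc \<and>
     (\<forall>c a b. sc c (a * b) = sc c a * b \<and> sc c (a * b) = a * sc c b) \<and>
     \<comment> \<open>D is linear\<close>
     (\<forall>a b. tensor_eq sc (D (a + b)) (D a @ D b)) \<and>
     (\<forall>c a. tensor_eq sc (D (sc c a)) (map (\<lambda>(x,y). (sc c x, y)) (D a))) \<and>
     \<comment> \<open>D is an algebra map\<close>
     (\<forall>a b. tensor_eq sc (D (a * b)) (tmul (D a) (D b))) \<and>
     tensor_eq sc (D 1) [(1, 1)] \<and>
     \<comment> \<open>coassociativity, (D \<otimes> id) D = (id \<otimes> D) D, tested on H' \<otimes> H' \<otimes> H'\<close>
     (\<forall>a \<mu> \<nu> \<rho>. dual_lin sc \<mu> \<and> dual_lin sc \<nu> \<and> dual_lin sc \<rho> \<longrightarrow>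
        sum_list (map (\<lambda>(x,y). pairing (D x) \<mu> \<nu> * \<rho> y) (D a)) =
        sum_list (map (\<lambda>(x,y). \<mu> x * pairing (D y) \<nu> \<rho>) (D a))) \<and>
     \<comment> \<open>counit\<close>
     dual_lin sc e \<and> (\<forall>a b. e (a * b) = e a * e b) \<and> e 1 = 1 \<and>
     (\<forall>a. sum_list (map (\<lambda>(x,y). sc (e x) y) (D a)) = a) \<and>
     (\<forall>a. sum_list (map (\<lambda>(x,y). sc (e y) x) (D a)) = a) \<and>
     \<comment> \<open>invertible antipode\<close>
     Vector_Spaces.linear sc sc S \<and> bij S \<and>
     (\<forall>a. sum_list (map (\<lambda>(x,y). S x * y) (D a)) = sc (e a) 1) \<and>
     (\<forall>a. sum_list (map (\<lambda>(x,y). x * S y) (D a)) = sc (e a) 1)"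

definition group_like :: "('k::field \<Rightarrow> 'h::ring_1 \<Rightarrow> 'h) \<Rightarrow> ('h \<Rightarrow> 'h tens) \<Rightarrow> 'h \<Rightarrow> bool" where
  "group_like sc D g \<longleftrightarrow> g \<noteq> 0 \<and> tensor_eq sc (D g) [(g, g)]"

definition integral_type :: "('k::field \<Rightarrow> 'h::ring_1 \<Rightarrow> 'h) \<Rightarrow> ('h \<Rightarrow> 'h tens) \<Rightarrow> 'h \<Rightarrow> bool" where
  "integral_type sc D \<Lambda> \<longleftrightarrow> \<Lambda> \<noteq> 0 \<and> tensor_eq sc (tmul (D \<Lambda>) [(1, \<Lambda>)]) [(\<Lambda>, \<Lambda>)]"

definition A_of :: "('k::field \<Rightarrow> 'h::ring_1 \<Rightarrow> 'h) \<Rightarrow> ('h \<Rightarrow> 'h tens) \<Rightarrow> 'h \<Rightarrow> 'h set" where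
  "A_of sc D \<Lambda> = {a. \<exists>b. tensor_eq sc (tmul (D a) [(1, \<Lambda>)]) [(b, \<Lambda>)]}"

definition V_of :: "('k::field \<Rightarrow> 'h::ring_1 \<Rightarrow> 'h) \<Rightarrow> ('h \<Rightarrow> 'h tens) \<Rightarrow> 'h \<Rightarrow> 'h set" where
  "V_of sc D \<Lambda> = {slice_right sc \<nu> (D \<Lambda>) | \<nu>. dual_lin sc \<nu>}"

text \<open>\<phi> is a linear functional on the subspace A (an element of A'); values off A are irrelevant.\<close>
definition lin_on :: "('k::field \<Rightarrow> 'h::ring_1 \<Rightarrow> 'h) \<Rightarrow> 'h set \<Rightarrow> ('h \<Rightarrow> 'k) \<Rightarrow> bool" where
  "lin_on sc A \<phi> \<longleftrightarrow> (\<forall>x\<in>A. \<forall>y\<in>A. \<phi> (x + y) = \<phi> x + \<phi> y) \<and>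
                      (\<forall>c. \<forall>x\<in>A. \<phi> (sc c x) = c * \<phi> x)"

text \<open>g-cointegral on a left coideal subalgebra A: (id \<otimes> \<phi>)(\<Delta> a) = \<phi>(a) g.
  Since \<Delta>(a) \<in> H \<otimes> A, (id \<otimes> \<phi>) is evaluated on representatives whose
  right tensor factors lie in A (the value does not depend on the choice).\<close>
definition cointegral ::
  "('k::field \<Rightarrow> 'h::ring_1 \<Rightarrow> 'h) \<Rightarrow> ('h \<Rightarrow> 'h tens) \<Rightarrow> 'h set \<Rightarrow> 'h \<Rightarrow> ('h \<Rightarrow> 'k) \<Rightarrow> bool" where
  "cointegral sc D A g \<phi> \<longleftrightarrow> lin_on sc A \<phi> \<and>
     (\<forall>a\<in>A. \<forall>t. tensor_eq sc t (D a) \<and> set (map snd t) \<subseteq> A \<longrightarrow>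
        slice_right sc \<phi> t = sc (\<phi> a) g)"

definition faithful :: "'h set \<Rightarrow> ('h::ring_1 \<Rightarrow> 'k::field) \<Rightarrow> bool" where
  "faithful A \<phi> \<longleftrightarrow> (\<forall>a\<in>A. (\<forall>b\<in>A. \<phi> (a * b) = 0) \<longrightarrow> a = 0)"

definition L_eps :: "('k::field \<Rightarrow> 'h::ring_1 \<Rightarrow> 'h) \<Rightarrow> ('h \<Rightarrow> 'k) \<Rightarrow> 'h set \<Rightarrow> 'h set" where
  "L_eps sc e A = {x\<in>A. \<forall>a\<in>A. a * x = sc (e a) x}"

definition R_eps :: "('k::field \<Rightarrow> 'h::ring_1 \<Rightarrow> 'h) \<Rightarrow> ('h \<Rightarrow> 'k) \<Rightarrow> 'h set \<Rightarrow> 'h set" where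
  "R_eps sc e A = {x\<in>A. \<forall>a\<in>A. x * a = sc (e a) x}"

end

theory Submission
  imports Defs
begin

text \<open>
  Write \<open>\<Delta>(a) = a\<^sub>1 \<otimes> a\<^sub>2\<close> and \<open>A = A\<^sub>\<Lambda>\<close>. Applying \<open>id \<otimes> \<Delta>\<close> to \<open>a\<^sub>1 \<otimes> a\<^sub>2\<Lambda> = b \<otimes> \<Lambda>\<close> and cancelling
  with the antipode gives \<open>\<Lambda>\<^sub>1 \<otimes> a\<Lambda>\<^sub>2 = S(b)\<Lambda>\<^sub>1 \<otimes> \<Lambda>\<^sub>2\<close>. This identity forces \<open>a = b\<close> and, via
  \<open>S(a) \<otimes> \<Lambda> = S(a)\<Lambda>\<^sub>1S(\<Lambda>\<^sub>2) \<otimes> \<Lambda>\<^sub>3\<close>, that \<open>A\<close> is finite-dimensional.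

  If \<open>\<phi>\<close> is a faithful \<open>g\<close>-cointegral, every functional on \<open>A\<close> is \<open>\<phi>(a \<cdot>)\<close> for some \<open>a \<in> A\<close>, and
  \<open>\<Lambda>\<^sub>1\<phi>(a\<Lambda>\<^sub>2) = S(a)\<Lambda>\<^sub>1\<phi>(\<Lambda>\<^sub>2) = \<phi>(\<Lambda>)S(a)g\<close>, so the left leg of \<open>\<Delta>(\<Lambda>)\<close> is \<open>\<phi>(\<Lambda>)S(A)g\<close>; it contains
  \<open>\<Lambda>\<close>, hence \<open>\<phi>(\<Lambda>) \<noteq> 0\<close>. Conversely, if the left leg is \<open>S(A)g\<close>, a functional \<open>\<phi>\<close> with
  \<open>\<Lambda>\<^sub>1\<phi>(\<Lambda>\<^sub>2) = g\<close> satisfies \<open>\<Lambda>\<^sub>1\<phi>(a\<Lambda>\<^sub>2) = S(a)g\<close>, so it is faithful; then the right leg of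
  \<open>\<Delta>(\<Lambda>)\<close> is all of \<open>A\<close>, and coassociativity makes \<open>\<phi>\<close> a cointegral. Part (1) follows from
  \<open>S(\<Lambda>)S(a)g = S(a\<Lambda>)g = \<epsilon>(a)S(\<Lambda>)g\<close>, and for part (2) faithfulness makes both spaces of integrals
  one-dimensional.
\<close>

section \<open>Bilinear evaluation of formal tensors\<close>

text \<open>For bilinear \<open>F\<close> this is the value at the tensor \<open>t\<close> of the
  linear map on H \<otimes> H induced by \<open>F\<close>; pairings and slices are instances. It is
  defined on lists, so bilinearity enters when one representative of a tensor replaces
  another.\<close>

definition tsum :: "('h \<Rightarrow> 'h \<Rightarrow> 'b::comm_monoid_add) \<Rightarrow> 'h tens \<Rightarrow> 'b" where
  "tsum F t = sum_list (map (\<lambda>(x,y). F x y) t)"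

lemma tsum_Nil [simp]: "tsum F [] = 0"
  and tsum_Cons [simp]: "tsum F (p # t) = F (fst p) (snd p) + tsum F t"
  and tsum_append [simp]: "tsum F (t @ u) = tsum F t + tsum F u"
  by (auto simp: tsum_def split: prod.split)

lemma tsum_map [simp]: "tsum F (map f t) = tsum (\<lambda>x y. F (fst (f (x, y))) (snd (f (x, y)))) t"
  by (induction t) auto

lemma tsum_zero [simp]: "tsum (\<lambda>x y. 0) t = 0"
  by (induction t) auto

lemma tsum_cong:
  "(\<And>x y. (x, y) \<in> set t \<Longrightarrow> F x y = G x y) \<Longrightarrow> tsum F t = tsum G t"
  by (induction t) auto

lemma tsum_add: "tsum (\<lambda>x y. F x y + G x y) t = tsum F t + tsum G t"
  by (induction t) (auto simp: ac_simps)

lemma tsum_sum: "tsum (\<lambda>x y. \<Sum>i\<in>I. F i x y) t = (\<Sum>i\<in>I. tsum (F i) t)"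
  by (induction t) (auto simp: sum.distrib)

lemma tsum_swap:
  "tsum (\<lambda>x y. tsum (\<lambda>u v. F x y u v) s) t = tsum (\<lambda>u v. tsum (\<lambda>x y. F x y u v) t) s"
  by (induction t) (auto simp: tsum_add)

lemma tsum_mult_left: "tsum (\<lambda>x y. c * F x y) t = c * tsum F t" for c :: "'r::semiring_0"
  by (induction t) (auto simp: distrib_left)

lemma tsum_mult_right: "tsum (\<lambda>x y. F x y * c) t = tsum F t * c" for c :: "'r::semiring_0"
  by (induction t) (auto simp: distrib_right)

lemma tsum_additive:
  fixes f :: "'a::ab_group_add \<Rightarrow> 'b::ab_group_add"
  assumes "\<And>x y. f (x + y) = f x + f y"
  shows "f (tsum F t) = tsum (\<lambda>x y. f (F x y)) t"
proof -
  have "f 0 = 0" using assms[of 0 0] by simp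
  then show ?thesis by (induction t) (auto simp: assms)
qed

lemma tsum_tmul: "tsum F (tmul t u) = tsum (\<lambda>x y. tsum (\<lambda>x' y'. F (x * x') (y * y')) u) t"
  by (induction t) (auto simp: tmul_def)

lemma pairing_tsum: "pairing t \<mu> \<nu> = tsum (\<lambda>x y. \<mu> x * \<nu> y) t"
  by (simp add: pairing_def tsum_def)

lemma slice_right_tsum: "slice_right sc \<nu> t = tsum (\<lambda>x y. sc (\<nu> y) x) t"
  by (simp add: slice_right_def tsum_def)

section \<open>Linear, bilinear and trilinear maps into an arbitrary target\<close>

lemma vector_space_field: "vector_space ((*) :: 'k::field \<Rightarrow> 'k \<Rightarrow> 'k)"
  by unfold_locales (auto simp: algebra_simps)

text \<open>The scalar action \<open>s\<close> of the target is a parameter, so the same rules serve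
  maps into H and into the field. The predicate does not include the vector space axioms, which
  keeps linearity goals purely syntactic.\<close>

definition lin where
  "lin sc s f \<longleftrightarrow> (\<forall>x y. f (x + y) = f x + f y) \<and> (\<forall>c x. f (sc c x) = s c (f x))"

definition bilin where
  "bilin sc s B \<longleftrightarrow> (\<forall>y. lin sc s (\<lambda>x. B x y)) \<and> (\<forall>x. lin sc s (B x))"

definition trilin where
  "trilin sc s T \<longleftrightarrow> (\<forall>z. bilin sc s (\<lambda>x y. T x y z)) \<and> (\<forall>x y. lin sc s (T x y))"

lemma lin_add: "lin sc s f \<Longrightarrow> f (x + y) = f x + f y"
  and lin_scale: "lin sc s f \<Longrightarrow> f (sc c x) = s c (f x)"
  by (auto simp: lin_def)

lemma lin_tsum:
  fixes f :: "'a::ab_group_add \<Rightarrow> 'b::ab_group_add"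
  assumes "lin sc s f"
  shows "f (tsum F t) = tsum (\<lambda>x y. f (F x y)) t"
  using assms by (intro tsum_additive) (simp add: lin_def)

lemma lin_sum:
  fixes f :: "'a::ab_group_add \<Rightarrow> 'b::ab_group_add"
  assumes "lin sc s f"
  shows "f (sum F I) = (\<Sum>i\<in>I. f (F i))"
proof -
  have "f (0 + 0) = f 0 + f 0" using assms unfolding lin_def by blast
  then have "f 0 = 0" by simp
  then show ?thesis using assms
    by (induction I rule: infinite_finite_induct) (auto simp: lin_def)
qed

lemma tsum_scale_left:
  assumes "vector_space s"
  shows "tsum (\<lambda>x y. s (c x y) w) t = s (tsum c t) w"
proof -
  interpret vector_space s by fact
  show ?thesis by (induction t) (auto simp: scale_left_distrib)
qed

lemma tsum_scale_right:
  assumes "vector_space s"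
  shows "tsum (\<lambda>x y. s c (F x y)) t = s c (tsum F t)"
proof -
  interpret vector_space s by fact
  show ?thesis by (induction t) (auto simp: scale_right_distrib)
qed

locale hopf =
  fixes sc :: "'k::field \<Rightarrow> 'h::ring_1 \<Rightarrow> 'h"
    and D :: "'h \<Rightarrow> 'h tens" and e :: "'h \<Rightarrow> 'k" and S :: "'h \<Rightarrow> 'h"
  assumes hopf: "hopf_algebra sc D e S"
begin

sublocale vector_space sc
  using hopf by (simp add: hopf_algebra_def)

section \<open>Linear functionals: coordinates, extension, separation\<close>

interpretation pair: vector_space_pair sc "(*) :: 'k \<Rightarrow> 'k \<Rightarrow> 'k"
  using vector_space_field by (simp add: vector_space_pair_def vector_space_axioms)

lemma dual_lin_iff: "dual_lin sc \<nu> \<longleftrightarrow> lin sc (*) \<nu>"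
  unfolding dual_lin_def linear_iff lin_def
  using vector_space_field vector_space_axioms by auto

text \<open>Take the coordinate functionals of a basis of H. Each vector has finite support, so the
  union \<open>F\<close> of the supports of the members of the finite set \<open>X\<close> is
  finite, and the remaining coordinates vanish on \<open>X\<close>.\<close>

lemma finite_dual_basis:
  assumes "finite X"
  obtains F d where "finite F" "\<And>b. lin sc (*) (d b)" "\<And>x. x \<in> X \<Longrightarrow> x = (\<Sum>b\<in>F. sc (d b x) b)"
proof -
  define B where "B = extend_basis {}"
  have B: "independent B" "span B = UNIV"
    unfolding B_def by (auto simp: independent_extend_basis span_extend_basis independent_empty)
  define d where "d b x = representation B x b" for b x
  have d: "lin sc (*) (d b)" for b
    unfolding d_def using linear_representation[OF B, of b]
    by (simp add: dual_lin_iff[symmetric] dual_lin_def)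
  define F where "F = (\<Union>x\<in>X. {b. d b x \<noteq> 0})"
  have fin: "finite {b. d b x \<noteq> 0}" for x
    unfolding d_def by (rule finite_representation)
  then have F: "finite F" unfolding F_def using assms by simp
  have "x = (\<Sum>b\<in>F. sc (d b x) b)" if "x \<in> X" for x
  proof -
    have "x = (\<Sum>b | d b x \<noteq> 0. sc (d b x) b)"
      unfolding d_def using sum_nonzero_representation_eq[OF B(1), of x] B(2) by simp
    also have "\<dots> = (\<Sum>b\<in>F. sc (d b x) b)"
      using that F by (intro sum.mono_neutral_left) (auto simp: F_def)
    finally show ?thesis .
  qed
  with F d show ?thesis using that by blast
qed

text \<open>A cointegral is linear only on its subalgebra; an extension to all of H can be applied
  to the legs of any representative. It is prescribed on a basis of \<open>A\<close>.\<close>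

lemma dual_extension:
  assumes "subspace A" "\<And>x y. x \<in> A \<Longrightarrow> y \<in> A \<Longrightarrow> \<phi> (x + y) = \<phi> x + \<phi> y"
    "\<And>c x. x \<in> A \<Longrightarrow> \<phi> (sc c x) = c * \<phi> x"
  obtains \<nu> where "lin sc (*) \<nu>" "\<And>x. x \<in> A \<Longrightarrow> \<nu> x = \<phi> x"
proof -
  obtain B where B: "B \<subseteq> A" "independent B" "A \<subseteq> span B" using maximal_independent_subset[of A] by blast
  obtain \<nu> where \<nu>: "\<And>x. x \<in> B \<Longrightarrow> \<nu> x = \<phi> x" "lin sc (*) \<nu>"
    using pair.linear_independent_extend[OF B(2), of \<phi>] dual_lin_iff dual_lin_def by metis
  have "x \<in> A \<and> \<nu> x = \<phi> x" if "x \<in> span B" for x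
    using that
  proof (induction rule: span_induct_alt)
    case base
    have "\<phi> (sc 0 0) = 0 * \<phi> 0" using assms(1,3) subspace_0 by blast
    moreover have "\<nu> (sc 0 0) = 0 * \<nu> 0" using \<nu>(2) unfolding lin_def by blast
    ultimately show ?case using assms(1) subspace_0 by simp
  next
    case (step c x y)
    then have xA: "x \<in> A" "y \<in> A" using B(1) by auto
    then have "sc c x \<in> A" using assms(1) subspace_scale by blast
    then show ?case using xA step \<nu> assms subspace_add by (auto simp: lin_def)
  qed
  with that \<nu>(2) B(3) show ?thesis by blast
qed

lemma separate_subspace:
  assumes "subspace W" "a \<notin> W"
  obtains \<nu> where "lin sc (*) \<nu>" "\<And>w. w \<in> W \<Longrightarrow> \<nu> w = 0" "\<nu> a = 1"
proof -
  obtain B where B: "B \<subseteq> W" "independent B" "W \<subseteq> span B" using maximal_independent_subset[of W] by blast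
  have sB: "span B = W" using B assms(1) by (simp add: span_subspace)
  then have "independent (insert a B)" using B(2) assms(2) independent_insertI by blast
  then obtain \<nu> where \<nu>: "\<And>x. x \<in> insert a B \<Longrightarrow> \<nu> x = (if x = a then 1 else 0)" "lin sc (*) \<nu>"
    using pair.linear_independent_extend[of "insert a B" "\<lambda>x. if x = a then 1 else 0"]
      dual_lin_iff dual_lin_def by metis
  have "\<nu> w = 0" if "w \<in> W" for w
  proof (rule pair.linear_eq_0_on_span[of \<nu> B])
    show "Vector_Spaces.linear sc (*) \<nu>"
      using \<nu>(2) by (simp flip: dual_lin_iff add: dual_lin_def)
    show "\<nu> x = 0" if "x \<in> B" for x using that \<nu>(1)[of x] assms(2) B(1) by auto
    show "w \<in> span B" using that sB by simp
  qed
  with that \<nu> show ?thesis by auto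
qed

lemma dual_nonzero:
  assumes "a \<noteq> 0"
  obtains \<nu> where "lin sc (*) \<nu>" "\<nu> a = 1"
  using separate_subspace[OF subspace_single_0, of a] assms by auto

lemma eq_by_duals:
  assumes "\<And>\<mu>. lin sc (*) \<mu> \<Longrightarrow> \<mu> x = \<mu> y"
  shows "x = y"
proof (rule ccontr)
  assume "x \<noteq> y"
  then obtain \<nu> where \<nu>: "lin sc (*) \<nu>" "\<nu> (x - y) = 1" using dual_nonzero[of "x - y"] by auto
  have "\<nu> ((x - y) + y) = \<nu> (x - y) + \<nu> y" using \<nu>(1) unfolding lin_def by blast
  with \<nu> assms[OF \<nu>(1)] show False by simp
qed

section \<open>From products of functionals to multilinear maps\<close>

lemma tensor_eq_iff:
  "tensor_eq sc t u \<longleftrightarrow> (\<forall>\<mu> \<nu>. lin sc (*) \<mu> \<longrightarrow> lin sc (*) \<nu> \<longrightarrow>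
     tsum (\<lambda>x y. \<mu> x * \<nu> y) t = tsum (\<lambda>x y. \<mu> x * \<nu> y) u)"
  by (auto simp: tensor_eq_def pairing_tsum dual_lin_iff)

lemma bilin_expand:
  assumes "vector_space s" "bilin sc s B"
    "x = (\<Sum>b\<in>F. sc (d b x) b)" "y = (\<Sum>b\<in>F. sc (d b y) b)"
  shows "B x y = (\<Sum>i\<in>F. \<Sum>j\<in>F. s (d i x * d j y) (B i j))"
proof -
  interpret s: vector_space s by fact
  have l1: "lin sc s (\<lambda>x. B x y)" and l2: "lin sc s (B x)" for x y using assms(2) by (auto simp: bilin_def)
  have "B x y = B (\<Sum>b\<in>F. sc (d b x) b) (\<Sum>b\<in>F. sc (d b y) b)"
    by (rule arg_cong2[OF assms(3,4)])
  also have "\<dots> = (\<Sum>i\<in>F. \<Sum>j\<in>F. B (sc (d i x) i) (sc (d j y) j))"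
    unfolding lin_sum[OF l1] by (simp only: lin_sum[OF l2])
  also have "\<dots> = (\<Sum>i\<in>F. \<Sum>j\<in>F. s (d i x * d j y) (B i j))"
    by (simp add: lin_scale[OF l1] lin_scale[OF l2] mult.commute)
  finally show ?thesis .
qed

text \<open>\<open>tensor_eq\<close> tests only products of two functionals. In finite coordinates
  every bilinear map is a combination of such products with coefficients \<open>B i j\<close>, so
  equal tensors have equal values under any bilinear map.\<close>

lemma tensor_eq_bilin:
  fixes B :: "'h \<Rightarrow> 'h \<Rightarrow> 'b::ab_group_add"
  assumes "vector_space s" "bilin sc s B" "tensor_eq sc t u"
  shows "tsum B t = tsum B u"
proof -
  interpret s: vector_space s by fact
  obtain F d where F: "finite F" "\<And>b. lin sc (*) (d b)"
    "\<And>x. x \<in> fst ` set (t @ u) \<union> snd ` set (t @ u) \<Longrightarrow> x = (\<Sum>b\<in>F. sc (d b x) b)"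
    by (rule finite_dual_basis[of "fst ` set (t @ u) \<union> snd ` set (t @ u)"]) auto
  have "tsum B v = (\<Sum>i\<in>F. \<Sum>j\<in>F. s (tsum (\<lambda>x y. d i x * d j y) v) (B i j))" if "set v \<subseteq> set (t @ u)" for v
  proof -
    have "tsum B v = tsum (\<lambda>x y. \<Sum>i\<in>F. \<Sum>j\<in>F. s (d i x * d j y) (B i j)) v"
    proof (rule tsum_cong)
      fix x y assume "(x, y) \<in> set v"
      then have "x \<in> fst ` set (t @ u)" "y \<in> snd ` set (t @ u)" using that by force+
      then show "B x y = (\<Sum>i\<in>F. \<Sum>j\<in>F. s (d i x * d j y) (B i j))"
        by (intro bilin_expand assms F(3) UnI1 UnI2)
    qed
    then show ?thesis by (simp add: tsum_sum tsum_scale_left[OF assms(1)])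
  qed
  moreover have "tsum (\<lambda>x y. d i x * d j y) t = tsum (\<lambda>x y. d i x * d j y) u" for i j
    using assms(3) F(2) by (simp add: tensor_eq_iff)
  ultimately show ?thesis by simp
qed

lemma coassoc_dual:
  assumes "lin sc (*) \<mu>" "lin sc (*) \<nu>" "lin sc (*) \<rho>"
  shows "tsum (\<lambda>x y. tsum (\<lambda>u v. \<mu> u * \<nu> v * \<rho> y) (D x)) (D a)
       = tsum (\<lambda>x y. tsum (\<lambda>u v. \<mu> x * \<nu> u * \<rho> v) (D y)) (D a)"
proof -
  have "sum_list (map (\<lambda>(x,y). pairing (D x) \<mu> \<nu> * \<rho> y) (D a)) =
        sum_list (map (\<lambda>(x,y). \<mu> x * pairing (D y) \<nu> \<rho>) (D a))"
    using hopf assms by (simp add: hopf_algebra_def dual_lin_iff)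
  then show ?thesis
    by (simp only: tsum_def[symmetric] pairing_tsum mult.assoc tsum_mult_left[symmetric] tsum_mult_right[symmetric])
qed

text \<open>The same passage for three legs: coassociativity is assumed on products of three
  functionals and is extended to trilinear maps through coordinates.\<close>

lemma coassoc:
  fixes T :: "'h \<Rightarrow> 'h \<Rightarrow> 'h \<Rightarrow> 'b::ab_group_add"
  assumes "vector_space s" "trilin sc s T"
  shows "tsum (\<lambda>x y. tsum (\<lambda>u v. T u v y) (D x)) (D a) = tsum (\<lambda>x y. tsum (\<lambda>u v. T x u v) (D y)) (D a)"
proof -
  interpret s: vector_space s by fact
  \<comment> \<open>\<open>P\<close> collects every leg at which \<open>T\<close> is evaluated on
    either side, so that a single finite \<open>F\<close> expands all of them.\<close>
  define P where "P = D a @ concat (map (\<lambda>(x, y). D x @ D y) (D a))"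
  obtain F d where F: "finite F" "\<And>b. lin sc (*) (d b)"
    "\<And>x. x \<in> fst ` set P \<union> snd ` set P \<Longrightarrow> x = (\<Sum>b\<in>F. sc (d b x) b)"
    by (rule finite_dual_basis[of "fst ` set P \<union> snd ` set P"]) auto
  have T: "T x y z = (\<Sum>i\<in>F. \<Sum>j\<in>F. \<Sum>k\<in>F. s (d i x * d j y * d k z) (T i j k))"
    if "x \<in> fst ` set P \<union> snd ` set P" "y \<in> fst ` set P \<union> snd ` set P" "z \<in> fst ` set P \<union> snd ` set P" for x y z
  proof -
    have l: "lin sc s (T x y)" using assms(2) by (simp add: trilin_def)
    have "T x y z = T x y (\<Sum>b\<in>F. sc (d b z) b)" by (rule arg_cong[OF F(3)[OF that(3)]])
    also have "\<dots> = (\<Sum>k\<in>F. s (d k z) (T x y k))"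
      using l by (simp only: lin_sum lin_scale)
    also have "\<dots> = (\<Sum>k\<in>F. s (d k z) (\<Sum>i\<in>F. \<Sum>j\<in>F. s (d i x * d j y) (T i j k)))"
    proof (intro sum.cong refl)
      fix k
      show "s (d k z) (T x y k) = s (d k z) (\<Sum>i\<in>F. \<Sum>j\<in>F. s (d i x * d j y) (T i j k))"
        using assms(2)
        by (intro arg_cong[of _ _ "s (d k z)"] bilin_expand assms(1) F(3) that) (simp add: trilin_def)
    qed
    also have "\<dots> = (\<Sum>k\<in>F. \<Sum>i\<in>F. \<Sum>j\<in>F. s (d i x * d j y * d k z) (T i j k))"
      by (simp only: s.scale_sum_right s.scale_scale mult.commute[of "d _ z"])
    also have "\<dots> = (\<Sum>i\<in>F. \<Sum>j\<in>F. \<Sum>k\<in>F. s (d i x * d j y * d k z) (T i j k))"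
      by (subst sum.swap, rule sum.cong[OF refl], rule sum.swap)
    finally show ?thesis .
  qed
  let ?T = "\<lambda>x y z. \<Sum>i\<in>F. \<Sum>j\<in>F. \<Sum>k\<in>F. s (d i x * d j y * d k z) (T i j k)"
  have P1: "x \<in> fst ` set P \<union> snd ` set P" "y \<in> fst ` set P \<union> snd ` set P" if "(x, y) \<in> set (D a)" for x y
    using that unfolding P_def by force+
  have P2: "u \<in> fst ` set P \<union> snd ` set P" "v \<in> fst ` set P \<union> snd ` set P"
    if "(x, y) \<in> set (D a)" "(u, v) \<in> set (D x) \<union> set (D y)" for x y u v
  proof -
    have "(u, v) \<in> set P" using that unfolding P_def by auto
    then show "u \<in> fst ` set P \<union> snd ` set P" "v \<in> fst ` set P \<union> snd ` set P" by force+
  qed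
  have "tsum (\<lambda>x y. tsum (\<lambda>u v. T u v y) (D x)) (D a) = tsum (\<lambda>x y. tsum (\<lambda>u v. ?T u v y) (D x)) (D a)"
    using P1 P2 by (intro tsum_cong T) blast+
  also have "\<dots> = (\<Sum>i\<in>F. \<Sum>j\<in>F. \<Sum>k\<in>F. s (tsum (\<lambda>x y. tsum (\<lambda>u v. d i u * d j v * d k y) (D x)) (D a)) (T i j k))"
    by (simp add: tsum_sum tsum_scale_left[OF assms(1)])
  also have "\<dots> = (\<Sum>i\<in>F. \<Sum>j\<in>F. \<Sum>k\<in>F. s (tsum (\<lambda>x y. tsum (\<lambda>u v. d i x * d j u * d k v) (D y)) (D a)) (T i j k))"
    using coassoc_dual F(2) by simp
  also have "\<dots> = tsum (\<lambda>x y. tsum (\<lambda>u v. ?T x u v) (D y)) (D a)"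
    by (simp add: tsum_sum tsum_scale_left[OF assms(1)])
  also have "\<dots> = tsum (\<lambda>x y. tsum (\<lambda>u v. T x u v) (D y)) (D a)"
    using P1 P2 by (intro tsum_cong T[symmetric]) blast+
  finally show ?thesis .
qed

subsection \<open>Hopf algebra identities\<close>

lemma scale_mult_left: "sc c a * b = sc c (a * b)"
  and scale_mult_right: "a * sc c b = sc c (a * b)"
  using hopf unfolding hopf_algebra_def by metis+

lemma lin_e: "lin sc (*) e" and e_mult: "e (a * b) = e a * e b" and e_one: "e 1 = 1"
  using hopf by (simp_all add: hopf_algebra_def dual_lin_iff)

lemma lin_S: "lin sc sc S" and bij_S: "bij S"
  using hopf by (simp_all add: hopf_algebra_def lin_def linear_iff)

lemma counit_left: "tsum (\<lambda>x y. sc (e x) y) (D a) = a"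
  and counit_right: "tsum (\<lambda>x y. sc (e y) x) (D a) = a"
  and antipode_left: "tsum (\<lambda>x y. S x * y) (D a) = sc (e a) 1"
  and antipode_right: "tsum (\<lambda>x y. x * S y) (D a) = sc (e a) 1"
  using hopf by (simp_all add: hopf_algebra_def tsum_def)

section \<open>Closure rules for linearity\<close>

lemma lin_comp: "lin sc s \<mu> \<Longrightarrow> lin sc sc f \<Longrightarrow> lin sc s (\<lambda>x. \<mu> (f x))"
  by (simp add: lin_def)

lemma bilin_comp:
  assumes "bilin sc s B"
  shows bilin_comp_left: "lin sc sc f \<Longrightarrow> lin sc s (\<lambda>x. B (f x) y)"
    and bilin_comp_right: "lin sc sc f \<Longrightarrow> lin sc s (\<lambda>x. B y (f x))"
  using assms by (simp_all add: lin_def bilin_def)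

lemma bilinI: "(\<And>y. lin sc s (\<lambda>x. B x y)) \<Longrightarrow> (\<And>x. lin sc s (\<lambda>y. B x y)) \<Longrightarrow> bilin sc s B"
  by (simp add: bilin_def)

lemma trilinI:
  "(\<And>y z. lin sc s (\<lambda>x. T x y z)) \<Longrightarrow> (\<And>x z. lin sc s (\<lambda>y. T x y z)) \<Longrightarrow> (\<And>x y. lin sc s (\<lambda>z. T x y z))
    \<Longrightarrow> trilin sc s T"
  by (simp add: trilin_def bilin_def)

lemma lin_tsum_pointwise:
  assumes "vector_space s" "\<And>u v. lin sc s (\<lambda>x. F x u v)"
  shows "lin sc s (\<lambda>x. tsum (F x) t)"
proof -
  have "F (x + y) = (\<lambda>u v. F x u v + F y u v)" "F (sc c x) = (\<lambda>u v. s c (F x u v))" for x y c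
    using assms(2) by (auto simp: lin_def fun_eq_iff)
  then show ?thesis
    by (simp add: lin_def tsum_add tsum_scale_right[OF assms(1)])
qed

text \<open>As a map into lists \<open>D\<close> is linear only up to \<open>tensor_eq\<close>; its
  composite with a bilinear evaluation is linear in the strict sense.\<close>

lemma lin_tsum_D:
  assumes "vector_space s" "bilin sc s B" "lin sc sc f"
  shows "lin sc s (\<lambda>x. tsum B (D (f x)))"
proof -
  have "tsum B (D (a + b)) = tsum B (D a) + tsum B (D b)" for a b
    using tensor_eq_bilin[OF assms(1,2), of "D (a + b)" "D a @ D b"] hopf by (simp add: hopf_algebra_def)
  moreover have "tsum B (D (sc c a)) = s c (tsum B (D a))" for c a
    using tensor_eq_bilin[OF assms(1,2), of "D (sc c a)" "map (\<lambda>(x,y). (sc c x, y)) (D a)"] hopf assms(2)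
    by (simp add: hopf_algebra_def case_prod_beta bilin_def lin_def tsum_scale_right[OF assms(1)])
  ultimately show ?thesis using assms(3) by (simp add: lin_def)
qed

lemma lin_id: "lin sc sc (\<lambda>x. x)"
  by (simp add: lin_def)

lemma lin_mult:
  assumes "lin sc sc f"
  shows lin_mult_const: "lin sc sc (\<lambda>x. f x * c)" and lin_const_mult: "lin sc sc (\<lambda>x. c * f x)"
  using assms by (simp_all add: lin_def distrib_left distrib_right scale_mult_left scale_mult_right)

lemma lin_mult_field:
  fixes f :: "'h \<Rightarrow> 'k"
  assumes "lin sc (*) f"
  shows lin_mult_const_field: "lin sc (*) (\<lambda>x. f x * c)" and lin_const_mult_field: "lin sc (*) (\<lambda>x. c * f x)"
  using assms by (simp_all only: lin_def distrib_left distrib_right mult.assoc mult.left_commute simp_thms)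

lemma lin_scale_const: "vector_space s \<Longrightarrow> lin sc s f \<Longrightarrow> lin sc s (\<lambda>x. s c (f x))"
  by (simp add: lin_def vector_space_def mult.commute)

lemma lin_const_scale: "vector_space s \<Longrightarrow> lin sc (*) f \<Longrightarrow> lin sc s (\<lambda>x. s (f x) v)"
  by (simp add: lin_def vector_space_def)

lemmas lin_intros = bilinI trilinI lin_id lin_mult_const lin_const_mult lin_mult_const_field lin_const_mult_field
  lin_comp[OF lin_S] lin_comp[OF lin_e] lin_tsum_pointwise lin_tsum_D vector_space_axioms vector_space_field
  lin_scale_const[OF vector_space_axioms] lin_const_scale[OF vector_space_axioms]

lemma D_mult:
  assumes "vector_space s" "bilin sc s B"
  shows "tsum B (D (a * b)) = tsum (\<lambda>x y. tsum (\<lambda>u v. B (x * u) (y * v)) (D b)) (D a)"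
  using tensor_eq_bilin[OF assms, of "D (a * b)" "tmul (D a) (D b)"] hopf
  by (simp add: hopf_algebra_def tsum_tmul)

lemma D_one: "vector_space s \<Longrightarrow> bilin sc s B \<Longrightarrow> tsum B (D 1) = B 1 1"
  using tensor_eq_bilin[of s B "D 1" "[(1, 1)]"] hopf by (simp add: hopf_algebra_def)

lemma counit_left_lin: "lin sc s f \<Longrightarrow> tsum (\<lambda>x y. s (e x) (f y)) (D a) = f a"
  for f :: "'h \<Rightarrow> 'b::ab_group_add"
  using lin_tsum[of sc s f "\<lambda>x y. sc (e x) y" "D a"] by (simp add: counit_left lin_scale)

lemma counit_right_lin: "lin sc s f \<Longrightarrow> tsum (\<lambda>x y. s (e y) (f x)) (D a) = f a"
  for f :: "'h \<Rightarrow> 'b::ab_group_add"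
  using lin_tsum[of sc s f "\<lambda>x y. sc (e y) x" "D a"] by (simp add: counit_right lin_scale)

section \<open>Counit and product under the antipode\<close>

lemma e_S: "e (S a) = e a"
proof -
  have "e (S a) = tsum (\<lambda>x y. e y * e (S x)) (D a)"
    by (rule counit_right_lin[symmetric]) (intro lin_intros)
  also have "\<dots> = e (tsum (\<lambda>x y. S x * y) (D a))"
    by (simp add: lin_tsum[OF lin_e] e_mult mult.commute)
  also have "\<dots> = e a" by (simp add: antipode_left lin_scale[OF lin_e] e_one)
  finally show ?thesis .
qed

lemma S_one: "S 1 = 1"
proof -
  have "S 1 * 1 = tsum (\<lambda>x y. S x * y) (D 1)"
    by (rule D_one[symmetric, OF vector_space_axioms]) (intro lin_intros)
  then show ?thesis by (simp add: antipode_left e_one)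
qed

text \<open>Uniqueness of convolution inverses: in
  \<open>S(b\<^sub>1)S(a\<^sub>1)a\<^sub>2b\<^sub>2S(a\<^sub>3b\<^sub>3)\<close> the first four
  factors collapse to counits and leave \<open>S(ab)\<close>, while the last three collapse to
  counits and leave \<open>S(b)S(a)\<close>.\<close>

lemma S_mult: "S (a * b) = S b * S a"
proof -
  have "S (a * b) = tsum (\<lambda>a1 a2. tsum (\<lambda>b1 b2. sc (e a1) (sc (e b1) (S (a2 * b2)))) (D b)) (D a)"
  proof -
    have "S (a * b) = tsum (\<lambda>a1 a2. sc (e a1) (S (a2 * b))) (D a)"
      by (rule counit_left_lin[symmetric]) (intro lin_intros)
    also have "\<dots> = tsum (\<lambda>a1 a2. sc (e a1) (tsum (\<lambda>b1 b2. sc (e b1) (S (a2 * b2))) (D b))) (D a)"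
      by (intro tsum_cong arg_cong[of _ _ "sc _"] counit_left_lin[symmetric]) (intro lin_intros)
    finally show ?thesis by (simp only: tsum_scale_right[OF vector_space_axioms])
  qed
  also have "\<dots> = tsum (\<lambda>a1 a2. tsum (\<lambda>b1 b2. tsum (\<lambda>a11 a12. tsum (\<lambda>b11 b12.
      S b11 * S a11 * a12 * b12 * S (a2 * b2)) (D b1)) (D a1)) (D b)) (D a)"
  proof (intro tsum_cong)
    fix a1 a2 b1 b2
    have "tsum (\<lambda>a11 a12. tsum (\<lambda>b11 b12. S b11 * S a11 * a12 * b12 * S (a2 * b2)) (D b1)) (D a1)
      = tsum (\<lambda>b11 b12. tsum (\<lambda>a11 a12. S b11 * (S a11 * a12) * (b12 * S (a2 * b2))) (D a1)) (D b1)"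
      by (subst tsum_swap) (simp only: mult.assoc)
    also have "\<dots> = tsum (\<lambda>b11 b12. sc (e a1) (S b11 * b12 * S (a2 * b2))) (D b1)"
      unfolding tsum_mult_right tsum_mult_left antipode_left
      by (simp only: scale_mult_right scale_mult_left mult.assoc mult_1_left)
    also have "\<dots> = sc (e a1) (tsum (\<lambda>b11 b12. S b11 * b12) (D b1) * S (a2 * b2))"
      by (simp only: tsum_scale_right[OF vector_space_axioms] tsum_mult_right)
    also have "\<dots> = sc (e a1) (sc (e b1) (S (a2 * b2)))"
      by (simp only: antipode_left scale_mult_left mult_1_left)
    finally show "sc (e a1) (sc (e b1) (S (a2 * b2))) = tsum (\<lambda>a11 a12. tsum (\<lambda>b11 b12.
      S b11 * S a11 * a12 * b12 * S (a2 * b2)) (D b1)) (D a1)" by simp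
  qed
  also have "\<dots> = tsum (\<lambda>b1 b2. tsum (\<lambda>a1 a2. tsum (\<lambda>a11 a12. tsum (\<lambda>b11 b12.
      S b11 * S a11 * a12 * b12 * S (a2 * b2)) (D b1)) (D a1)) (D a)) (D b)"
    by (rule tsum_swap)
  \<comment> \<open>Coassociativity, first in \<open>a\<close> and below in \<open>b\<close>,
    regroups the middle factors with the last one.\<close>
  also have "\<dots> = tsum (\<lambda>b1 b2. tsum (\<lambda>a1 a2. tsum (\<lambda>a11 a12. tsum (\<lambda>b11 b12.
      S b11 * S a1 * a11 * b12 * S (a12 * b2)) (D b1)) (D a2)) (D a)) (D b)"
    by (intro tsum_cong coassoc[OF vector_space_axioms]) (intro lin_intros)
  also have "\<dots> = tsum (\<lambda>a1 a2. tsum (\<lambda>a11 a12. tsum (\<lambda>b1 b2. tsum (\<lambda>b11 b12.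
      S b11 * S a1 * a11 * b12 * S (a12 * b2)) (D b1)) (D b)) (D a2)) (D a)"
    by (subst tsum_swap, intro tsum_cong, rule tsum_swap)
  also have "\<dots> = tsum (\<lambda>a1 a2. tsum (\<lambda>a11 a12. tsum (\<lambda>b1 b2. tsum (\<lambda>b11 b12.
      S b1 * S a1 * a11 * b11 * S (a12 * b12)) (D b2)) (D b)) (D a2)) (D a)"
    by (intro tsum_cong coassoc[OF vector_space_axioms]) (intro lin_intros)
  also have "\<dots> = tsum (\<lambda>a1 a2. tsum (\<lambda>b1 b2. tsum (\<lambda>a11 a12. tsum (\<lambda>b11 b12.
      S b1 * S a1 * a11 * b11 * S (a12 * b12)) (D b2)) (D a2)) (D b)) (D a)"
    by (intro tsum_cong, rule tsum_swap)
  also have "\<dots> = tsum (\<lambda>a1 a2. tsum (\<lambda>b1 b2. sc (e b2) (sc (e a2) (S b1 * S a1))) (D b)) (D a)"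
  proof (intro tsum_cong)
    fix a1 a2 b1 b2
    have "tsum (\<lambda>a11 a12. tsum (\<lambda>b11 b12. S b1 * S a1 * a11 * b11 * S (a12 * b12)) (D b2)) (D a2)
      = S b1 * S a1 * tsum (\<lambda>a11 a12. tsum (\<lambda>b11 b12. (a11 * b11) * S (a12 * b12)) (D b2)) (D a2)"
      by (simp only: mult.assoc tsum_mult_left[symmetric])
    also have "tsum (\<lambda>a11 a12. tsum (\<lambda>b11 b12. (a11 * b11) * S (a12 * b12)) (D b2)) (D a2) = sc (e (a2 * b2)) 1"
      unfolding antipode_right[symmetric]
      by (rule D_mult[symmetric, OF vector_space_axioms]) (intro lin_intros)
    finally show "tsum (\<lambda>a11 a12. tsum (\<lambda>b11 b12. S b1 * S a1 * a11 * b11 * S (a12 * b12)) (D b2)) (D a2)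
       = sc (e b2) (sc (e a2) (S b1 * S a1))"
      by (simp add: scale_mult_right e_mult mult.commute)
  qed
  also have "\<dots> = tsum (\<lambda>a1 a2. sc (e a2) (S b * S a1)) (D a)"
    by (intro tsum_cong counit_right_lin) (intro lin_intros)
  also have "\<dots> = S b * S a"
    by (intro counit_right_lin lin_intros)
  finally show ?thesis .
qed

end

section \<open>Elements of integral type\<close>

locale integral = hopf sc D e S
  for sc :: "'k::field \<Rightarrow> 'h::ring_1 \<Rightarrow> 'h"
    and D :: "'h \<Rightarrow> 'h tens" and e :: "'h \<Rightarrow> 'k" and S :: "'h \<Rightarrow> 'h" +
  fixes \<Lambda> :: 'h
  assumes integral: "integral_type sc D \<Lambda>"
begin

text \<open>The witness \<open>b\<close> of membership in \<open>A_of\<close> is kept as an argument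
  until \<open>act_eq\<close> identifies it with \<open>a\<close>.\<close>

definition act :: "'h \<Rightarrow> 'h \<Rightarrow> bool" where
  "act a b \<longleftrightarrow> tensor_eq sc (tmul (D a) [(1, \<Lambda>)]) [(b, \<Lambda>)]"

lemma \<Lambda>_nonzero: "\<Lambda> \<noteq> 0" and act_\<Lambda>: "act \<Lambda> \<Lambda>"
  using integral by (auto simp: integral_type_def act_def)

lemma act_bilin:
  assumes "act a b" "vector_space s" "bilin sc s B"
  shows "tsum (\<lambda>x y. B x (y * \<Lambda>)) (D a) = B b \<Lambda>"
  using tensor_eq_bilin[OF assms(2,3)] assms(1) by (fastforce simp: act_def tsum_tmul)

lemma actI:
  assumes "\<And>\<mu> \<nu>. lin sc (*) \<mu> \<Longrightarrow> lin sc (*) \<nu> \<Longrightarrow> tsum (\<lambda>x y. \<mu> x * \<nu> (y * \<Lambda>)) (D a) = \<mu> b * \<nu> \<Lambda>"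
  shows "act a b"
  using assms by (simp add: act_def tensor_eq_iff tsum_tmul)

text \<open>Both sides evaluate \<open>S(a\<^sub>1)a\<^sub>2\<Lambda>\<^sub>1 \<otimes>
  a\<^sub>3\<Lambda>\<^sub>2\<close>: read as \<open>S(a\<^sub>1)\<close> times
  \<Delta>(\<open>a\<^sub>2\<Lambda>\<close>) it is governed by \<open>act\<close>, while cancelling
  \<open>S(a\<^sub>1)a\<^sub>2\<close> leaves
  \<open>\<Lambda>\<^sub>1 \<otimes> a\<Lambda>\<^sub>2\<close>.\<close>

lemma act_antipode:
  assumes act: "act a b" and s: "vector_space s" and B: "bilin sc s B"
  shows "tsum (\<lambda>x y. B x (a * y)) (D \<Lambda>) = tsum (\<lambda>x y. B (S b * x) y) (D \<Lambda>)"
proof -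
  note li = lin_intros s bilin_comp_left[OF B] bilin_comp_right[OF B]
  have "tsum (\<lambda>x y. B (S b * x) y) (D \<Lambda>) = tsum (\<lambda>x y. tsum (\<lambda>u v. B (S x * u) v) (D (y * \<Lambda>))) (D a)"
    by (rule act_bilin[OF act s, symmetric]) (intro li)
  also have "\<dots> = tsum (\<lambda>x y. tsum (\<lambda>u v. tsum (\<lambda>p q. B (S x * (u * p)) (v * q)) (D \<Lambda>)) (D y)) (D a)"
    by (intro tsum_cong D_mult[OF s]) (intro li)
  also have "\<dots> = tsum (\<lambda>x y. tsum (\<lambda>u v. tsum (\<lambda>p q. B (S u * (v * p)) (y * q)) (D \<Lambda>)) (D x)) (D a)"
    by (rule coassoc[OF s, symmetric]) (intro li)
  also have "\<dots> = tsum (\<lambda>x y. tsum (\<lambda>p q. tsum (\<lambda>u v. B (S u * (v * p)) (y * q)) (D x)) (D \<Lambda>)) (D a)"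
    by (intro tsum_cong, rule tsum_swap)
  also have "\<dots> = tsum (\<lambda>x y. tsum (\<lambda>p q. s (e x) (B p (y * q))) (D \<Lambda>)) (D a)"
  proof (intro tsum_cong)
    fix x y p q
    have l: "lin sc s (\<lambda>z. B (z * p) (y * q))" by (intro li)
    have "tsum (\<lambda>u v. B (S u * (v * p)) (y * q)) (D x) = B (tsum (\<lambda>u v. S u * v) (D x) * p) (y * q)"
      by (simp only: lin_tsum[OF l] mult.assoc)
    also have "\<dots> = s (e x) (B p (y * q))"
      by (simp only: antipode_left lin_scale[OF l] mult_1_left)
    finally show "tsum (\<lambda>u v. B (S u * (v * p)) (y * q)) (D x) = s (e x) (B p (y * q))" .
  qed
  also have "\<dots> = tsum (\<lambda>p q. tsum (\<lambda>x y. s (e x) (B p (y * q))) (D a)) (D \<Lambda>)"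
    by (rule tsum_swap)
  also have "\<dots> = tsum (\<lambda>p q. B p (a * q)) (D \<Lambda>)"
    by (intro tsum_cong counit_left_lin) (intro li)
  finally show ?thesis ..
qed

lemma act_mult: assumes "act a b" shows "a * \<Lambda> = sc (e b) \<Lambda>"
proof -
  have "a * \<Lambda> = tsum (\<lambda>x y. sc (e x) (y * \<Lambda>)) (D a)"
    by (rule counit_left_lin[symmetric]) (intro lin_intros)
  also have "\<dots> = sc (e b) \<Lambda>"
    by (intro act_bilin[OF assms vector_space_axioms] lin_intros)
  finally show ?thesis .
qed

lemma act_S_mult: assumes "act a b" shows "S b * \<Lambda> = sc (e a) \<Lambda>"
proof -
  have "S b * \<Lambda> = tsum (\<lambda>x y. sc (e y) (S b * x)) (D \<Lambda>)"
    by (rule counit_right_lin[symmetric]) (intro lin_intros)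
  also have "\<dots> = tsum (\<lambda>x y. sc (e (a * y)) x) (D \<Lambda>)"
    by (rule act_antipode[OF assms vector_space_axioms, symmetric]) (intro lin_intros)
  also have "\<dots> = sc (e a) (tsum (\<lambda>x y. sc (e y) x) (D \<Lambda>))"
    by (simp only: e_mult scale_scale[symmetric] tsum_scale_right[OF vector_space_axioms])
  finally show ?thesis by (simp only: counit_right)
qed

text \<open>Evaluate \<open>\<Lambda>\<^sub>1 \<otimes> a\<Lambda>\<^sub>2\<Lambda>\<close> under
  \<eta> \<otimes> \<eta>. Integrality of \<Lambda> gives \<eta>(\<Lambda>)\<eta>(a\<Lambda>), which
  is \<open>e b\<close>; moving \<open>a\<close> to the left leg first gives
  \<eta>(S(b)\<Lambda>)\<eta>(\<Lambda>), which is \<open>e a\<close>.\<close>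

lemma act_counit: assumes "act a b" shows "e a = e b"
proof -
  obtain \<eta> where \<eta>: "lin sc (*) \<eta>" "\<eta> \<Lambda> = 1" using dual_nonzero[OF \<Lambda>_nonzero] by blast
  note li = lin_intros lin_comp[OF \<eta>(1)]
  have "\<eta> \<Lambda> * \<eta> (a * \<Lambda>) = tsum (\<lambda>x y. \<eta> x * \<eta> (a * (y * \<Lambda>))) (D \<Lambda>)"
    by (rule act_bilin[OF act_\<Lambda>, symmetric, OF vector_space_field]) (intro li)
  also have "\<dots> = tsum (\<lambda>x y. \<eta> x * \<eta> (a * y * \<Lambda>)) (D \<Lambda>)" by (simp only: mult.assoc)
  also have "\<dots> = tsum (\<lambda>x y. \<eta> (S b * x) * \<eta> (y * \<Lambda>)) (D \<Lambda>)"
    by (rule act_antipode[OF assms vector_space_field]) (intro li)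
  also have "\<dots> = \<eta> (S b * \<Lambda>) * \<eta> \<Lambda>"
    by (rule act_bilin[OF act_\<Lambda> vector_space_field]) (intro li)
  finally show ?thesis
    using act_mult[OF assms] act_S_mult[OF assms] \<eta> by (simp add: lin_scale[OF \<eta>(1)])
qed

text \<open>Applying \<Delta> to the first leg of the relation yields \<open>a\<^sub>1 \<otimes>
  a\<^sub>2 \<otimes> a\<^sub>3\<Lambda> = b\<^sub>1 \<otimes> b\<^sub>2 \<otimes>
  \<Lambda>\<close>, and \<mu> then consumes the first leg.\<close>

lemma act_coideal:
  assumes "act a b" "lin sc (*) \<mu>"
  shows "act (tsum (\<lambda>x y. sc (\<mu> x) y) (D a)) (tsum (\<lambda>x y. sc (\<mu> x) y) (D b))"
proof (rule actI)
  fix \<rho> \<nu> :: "'h \<Rightarrow> 'k" assume l: "lin sc (*) \<rho>" "lin sc (*) \<nu>"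
  note li = lin_intros l lin_comp[OF l(1)] lin_comp[OF l(2)] lin_comp[OF assms(2)]
  have lD: "lin sc (*) (\<lambda>z. tsum (\<lambda>u v. \<rho> u * \<nu> (v * \<Lambda>)) (D z))" by (intro li)
  have "tsum (\<lambda>x y. \<rho> x * \<nu> (y * \<Lambda>)) (D (tsum (\<lambda>x y. sc (\<mu> x) y) (D a)))
     = tsum (\<lambda>x y. tsum (\<lambda>u v. \<mu> x * (\<rho> u * \<nu> (v * \<Lambda>))) (D y)) (D a)"
    by (simp only: lin_tsum[OF lD] lin_scale[OF lD] tsum_mult_left)
  also have "\<dots> = tsum (\<lambda>x y. tsum (\<lambda>u v. \<mu> u * (\<rho> v * \<nu> (y * \<Lambda>))) (D x)) (D a)"
    by (rule coassoc[OF vector_space_field, symmetric]) (intro li)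
  also have "\<dots> = tsum (\<lambda>u v. \<mu> u * (\<rho> v * \<nu> \<Lambda>)) (D b)"
    by (rule act_bilin[OF assms(1) vector_space_field]) (intro li)
  also have "\<dots> = \<rho> (tsum (\<lambda>x y. sc (\<mu> x) y) (D b)) * \<nu> \<Lambda>"
    by (simp only: lin_tsum[OF l(1)] lin_scale[OF l(1)] tsum_mult_right[symmetric] mult.assoc)
  finally show "tsum (\<lambda>x y. \<rho> x * \<nu> (y * \<Lambda>)) (D (tsum (\<lambda>x y. sc (\<mu> x) y) (D a)))
     = \<rho> (tsum (\<lambda>x y. sc (\<mu> x) y) (D b)) * \<nu> \<Lambda>" .
qed

text \<open>The counits of all \<open>(\<mu> \<otimes> id)\<Delta>(a)\<close> and \<open>(\<mu> \<otimes> id)\<Delta>(b)\<close> agree, so all functionals agree on \<open>a\<close> and \<open>b\<close>.\<close>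

lemma act_eq: assumes "act a b" shows "b = a"
proof (rule eq_by_duals)
  fix \<mu> :: "'h \<Rightarrow> 'k" assume l: "lin sc (*) \<mu>"
  have "e (tsum (\<lambda>x y. sc (\<mu> x) y) (D c)) = \<mu> c" for c
    using counit_right_lin[OF l, of c] by (simp add: lin_tsum[OF lin_e] lin_scale[OF lin_e] mult.commute)
  then show "\<mu> b = \<mu> a" using act_counit[OF act_coideal[OF assms l]] by simp
qed

section \<open>The left coideal subalgebra attached to \<Lambda>\<close>

abbreviation A where "A \<equiv> A_of sc D \<Lambda>"

lemma A_iff_act: "a \<in> A \<longleftrightarrow> act a a"
  using act_eq by (auto simp: A_of_def act_def)

lemma \<Lambda>_in_A: "\<Lambda> \<in> A"
  using act_\<Lambda> A_iff_act by blast

lemma A_mult_\<Lambda>: "a \<in> A \<Longrightarrow> a * \<Lambda> = sc (e a) \<Lambda>"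
  and A_S_mult_\<Lambda>: "a \<in> A \<Longrightarrow> S a * \<Lambda> = sc (e a) \<Lambda>"
  using act_mult act_S_mult A_iff_act by blast+

lemma A_coideal: "a \<in> A \<Longrightarrow> lin sc (*) \<mu> \<Longrightarrow> tsum (\<lambda>x y. sc (\<mu> x) y) (D a) \<in> A"
  using act_coideal A_iff_act by blast

lemma one_in_A: "1 \<in> A"
proof -
  have "act 1 1"
  proof (rule actI)
    fix \<mu> \<nu> :: "'h \<Rightarrow> 'k" assume l: "lin sc (*) \<mu>" "lin sc (*) \<nu>"
    have "tsum (\<lambda>x y. \<mu> x * \<nu> (y * \<Lambda>)) (D 1) = \<mu> 1 * \<nu> (1 * \<Lambda>)"
      by (rule D_one[OF vector_space_field]) (intro lin_intros l lin_comp[OF l(2)])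
    then show "tsum (\<lambda>x y. \<mu> x * \<nu> (y * \<Lambda>)) (D 1) = \<mu> 1 * \<nu> \<Lambda>" by simp
  qed
  then show ?thesis using A_iff_act by simp
qed

lemma subspace_A: "subspace A"
proof -
  have lD: "lin sc (*) (\<lambda>z. tsum (\<lambda>u v. \<rho> u * \<nu> (v * \<Lambda>)) (D z))"
    if "lin sc (*) \<rho>" "lin sc (*) \<nu>" for \<rho> \<nu> :: "'h \<Rightarrow> 'k"
    by (intro lin_intros that lin_comp[OF that(2)])
  have act: "tsum (\<lambda>u v. \<rho> u * \<nu> (v * \<Lambda>)) (D z) = \<rho> z * \<nu> \<Lambda>"
    if "z \<in> A" "lin sc (*) \<rho>" "lin sc (*) \<nu>" for z and \<rho> \<nu> :: "'h \<Rightarrow> 'k"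
    using that A_iff_act by (intro act_bilin[OF _ vector_space_field] lin_intros) auto
  have add: "x + y \<in> A" if "x \<in> A" "y \<in> A" for x y
    unfolding A_iff_act
    by (rule actI) (simp add: lin_add[OF lD] act that lin_add[of sc "(*)"] distrib_right)
  have scale: "sc c x \<in> A" if "x \<in> A" for x c
    unfolding A_iff_act
    by (rule actI) (simp add: lin_scale[OF lD] act that lin_scale[of sc "(*)"] mult.assoc)
  show ?thesis
    unfolding subspace_def using add scale scale[OF one_in_A, of 0] by auto
qed

text \<open>In \<open>a\<^sub>1b\<^sub>1 \<otimes> a\<^sub>2b\<^sub>2\<Lambda>\<close> the relation
  for \<open>b\<close> is used first, leaving
  \<open>a\<^sub>1b \<otimes> a\<^sub>2\<Lambda>\<close>, and then the relation for
  \<open>a\<close>.\<close>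

lemma A_mult:
  assumes "a \<in> A" "b \<in> A"
  shows "a * b \<in> A"
proof -
  have "act (a * b) (a * b)"
  proof (rule actI)
    fix \<mu> \<nu> :: "'h \<Rightarrow> 'k" assume l: "lin sc (*) \<mu>" "lin sc (*) \<nu>"
    note li = lin_intros l lin_comp[OF l(1)] lin_comp[OF l(2)]
    have "tsum (\<lambda>x y. \<mu> x * \<nu> (y * \<Lambda>)) (D (a * b))
      = tsum (\<lambda>x y. tsum (\<lambda>u v. \<mu> (x * u) * \<nu> (y * v * \<Lambda>)) (D b)) (D a)"
      by (rule D_mult[OF vector_space_field]) (intro li)
    also have "\<dots> = tsum (\<lambda>x y. tsum (\<lambda>u v. \<mu> (x * u) * \<nu> (y * (v * \<Lambda>))) (D b)) (D a)"
      by (simp only: mult.assoc)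
    also have "\<dots> = tsum (\<lambda>x y. \<mu> (x * b) * \<nu> (y * \<Lambda>)) (D a)"
      using assms(2) A_iff_act by (intro tsum_cong act_bilin[OF _ vector_space_field]) (auto intro!: li)
    also have "\<dots> = \<mu> (a * b) * \<nu> \<Lambda>"
      using assms(1) A_iff_act by (intro act_bilin[OF _ vector_space_field]) (auto intro!: li)
    finally show "tsum (\<lambda>x y. \<mu> x * \<nu> (y * \<Lambda>)) (D (a * b)) = \<mu> (a * b) * \<nu> \<Lambda>" .
  qed
  then show ?thesis using A_iff_act by simp
qed

section \<open>Finite dimension and representation of functionals\<close>

lemma slice_mult:
  assumes "a \<in> A" "lin sc (*) \<nu>"
  shows "tsum (\<lambda>x y. sc (\<nu> (a * y)) x) (D \<Lambda>) = S a * tsum (\<lambda>x y. sc (\<nu> y) x) (D \<Lambda>)"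
proof -
  have "tsum (\<lambda>x y. sc (\<nu> (a * y)) x) (D \<Lambda>) = tsum (\<lambda>x y. sc (\<nu> y) (S a * x)) (D \<Lambda>)"
    using assms A_iff_act by (intro act_antipode[OF _ vector_space_axioms]) (auto intro!: lin_intros)
  then show ?thesis by (simp only: scale_mult_right[symmetric] tsum_mult_left)
qed

text \<open>Write \<open>S a\<close> as \<open>S(a)\<Lambda>\<^sub>1G(\<Lambda>\<^sub>2)\<close> and
  move \<open>S a\<close> into the coefficient functionals by \<open>slice_mult\<close>: the vectors
  that remain do not depend on \<open>a\<close>. Injectivity of \<open>S\<close> later transfers
  finiteness to \<open>A\<close>.\<close>

lemma S_A_finite_dim: "\<exists>X. finite X \<and> S ` A \<subseteq> span X"
proof -
  obtain \<eta> where \<eta>: "lin sc (*) \<eta>" "\<eta> \<Lambda> = 1" using dual_nonzero[OF \<Lambda>_nonzero] by blast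
  \<comment> \<open>\<open>G(y) = S(y\<^sub>1)\<eta>(y\<^sub>2)\<close>, so
    \<open>\<Lambda>\<^sub>1G(\<Lambda>\<^sub>2)\<close> collapses to \<eta>(\<Lambda>)1 =
    1.\<close>
  define G where "G y = tsum (\<lambda>u v. sc (\<eta> v) (S u)) (D y)" for y
  note li = lin_intros \<eta>(1)
  have linG: "lin sc sc G" unfolding G_def by (intro li)
  have G1: "tsum (\<lambda>x y. x * G y) (D \<Lambda>) = 1"
  proof -
    have "tsum (\<lambda>x y. x * G y) (D \<Lambda>) = tsum (\<lambda>x y. tsum (\<lambda>u v. sc (\<eta> v) (x * S u)) (D y)) (D \<Lambda>)"
      by (simp only: G_def tsum_mult_left[symmetric] scale_mult_right)
    also have "\<dots> = tsum (\<lambda>x y. tsum (\<lambda>u v. sc (\<eta> y) (u * S v)) (D x)) (D \<Lambda>)"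
      by (rule coassoc[OF vector_space_axioms, symmetric]) (intro li)
    also have "\<dots> = tsum (\<lambda>x y. sc (e x) (sc (\<eta> y) 1)) (D \<Lambda>)"
      by (simp only: tsum_scale_right[OF vector_space_axioms] antipode_right scale_scale mult.commute)
    also have "\<dots> = sc (\<eta> \<Lambda>) 1"
      by (rule counit_left_lin) (intro li)
    finally show ?thesis using \<eta>(2) by simp
  qed
  obtain F d where F: "finite F" "\<And>b. lin sc (*) (d b)"
    "\<And>x. x \<in> snd ` set (D \<Lambda>) \<Longrightarrow> x = (\<Sum>b\<in>F. sc (d b x) b)"
    by (rule finite_dual_basis[of "snd ` set (D \<Lambda>)"]) auto
  define X where "X = (\<lambda>(b, x). x * G b) ` (F \<times> fst ` set (D \<Lambda>))"
  have "S a \<in> span X" if a: "a \<in> A" for a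
  proof -
    have "S a = S a * tsum (\<lambda>x y. x * G y) (D \<Lambda>)" by (simp only: G1 mult_1_right)
    also have "\<dots> = S a * tsum (\<lambda>x y. \<Sum>b\<in>F. sc (d b y) x * G b) (D \<Lambda>)"
    proof (intro arg_cong[of _ _ "(*) (S a)"] tsum_cong)
      fix x y assume xy: "(x, y) \<in> set (D \<Lambda>)"
      then have "y \<in> snd ` set (D \<Lambda>)" by force
      then have "x * G y = x * G (\<Sum>b\<in>F. sc (d b y) b)" by (intro arg_cong[of _ _ "\<lambda>y. x * G y"] F(3))
      also have "\<dots> = (\<Sum>b\<in>F. sc (d b y) x * G b)"
        by (simp only: lin_sum[OF linG] lin_scale[OF linG] sum_distrib_left scale_mult_left scale_mult_right)
      finally show "x * G y = (\<Sum>b\<in>F. sc (d b y) x * G b)" .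
    qed
    also have "\<dots> = (\<Sum>b\<in>F. (S a * tsum (\<lambda>x y. sc (d b y) x) (D \<Lambda>)) * G b)"
      by (simp only: tsum_sum sum_distrib_left mult.assoc tsum_mult_right[symmetric])
    also have "\<dots> = (\<Sum>b\<in>F. tsum (\<lambda>x y. sc (d b (a * y)) (x * G b)) (D \<Lambda>))"
      by (simp only: slice_mult[OF a F(2), symmetric] tsum_mult_right[symmetric] scale_mult_left)
    also have "\<dots> \<in> span X"
    proof (rule span_sum)
      fix b assume b: "b \<in> F"
      have "tsum (\<lambda>x y. sc (d b (a * y)) (x * G b)) t \<in> span X" if "set t \<subseteq> set (D \<Lambda>)" for t
        using that
      proof (induction t)
        case (Cons p t)
        have "fst p * G b \<in> X" unfolding X_def using b Cons.prems by force
        then show ?case using Cons by (auto intro: span_add[OF span_scale[OF span_base]])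
      qed (simp add: span_zero)
      then show "tsum (\<lambda>x y. sc (d b (a * y)) (x * G b)) (D \<Lambda>) \<in> span X" by blast
    qed
    finally show ?thesis .
  qed
  moreover have "finite X" unfolding X_def using F(1) by simp
  ultimately show ?thesis by blast
qed

text \<open>Faithfulness makes \<open>a\<close> \<mapsto> \<nu>(a\<cdot>) injective from
  \<open>A\<close> to its dual; both have the same finite dimension, so the map is onto.\<close>

lemma faithful_functional_represents_dual:
  assumes \<nu>: "lin sc (*) \<nu>" and f: "faithful A \<nu>" and \<rho>: "lin sc (*) \<rho>"
  obtains a where "a \<in> A" "\<And>b. b \<in> A \<Longrightarrow> \<rho> b = \<nu> (a * b)"
proof -
  interpret pair: vector_space_pair sc sc by unfold_locales
  obtain X where X: "finite X" "S ` A \<subseteq> span X" using S_A_finite_dim by blast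
  obtain B where B: "B \<subseteq> A" "independent B" "A \<subseteq> span B" using maximal_independent_subset[of A] by blast
  have sB: "span B = A" using B subspace_A by (simp add: span_subspace)
  have linear_lin: "Vector_Spaces.linear sc sc h" if "lin sc sc h" for h
    using that vector_space_axioms by (simp add: linear_iff lin_def)
  have "independent (S ` B)"
    using pair.linear_independent_injective_image[OF linear_lin[OF lin_S] B(2)] bij_S
    by (meson bij_is_inj inj_on_subset subset_UNIV)
  then have "finite (S ` B)" using independent_span_bound[OF X(1)] X(2) B(1) by blast
  then have finB: "finite B"
    by (rule finite_imageD[OF _ inj_on_subset[OF bij_is_inj[OF bij_S] subset_UNIV]])
  \<comment> \<open>A functional on \<open>A\<close> is encoded by the vector whose coordinates are
    its values on \<open>B\<close>. The injection into the dual thus becomes an endomorphism of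
    \<open>A\<close>, and surjectivity follows by counting independent vectors.\<close>
  define T where "T a = (\<Sum>b\<in>B. sc (\<nu> (a * b)) b)" for a
  have linT: "lin sc sc T"
    unfolding T_def lin_def
    by (simp add: distrib_right lin_add[OF \<nu>] lin_scale[OF \<nu>] scale_left_distrib sum.distrib scale_mult_left scale_sum_right)
  have \<nu>_span: "\<rho>' b = \<nu> (a * b)"
    if "lin sc (*) \<rho>'" "\<And>b. b \<in> B \<Longrightarrow> \<rho>' b = \<nu> (a * b)" "b \<in> A" for \<rho>' :: "'h \<Rightarrow> 'k" and a b
  proof -
    have "b \<in> span B" using that(3) sB by simp
    then show ?thesis
    proof (induction rule: span_induct_alt)
      case base
      show ?case using lin_scale[OF \<nu>, of 0 0] lin_scale[OF that(1), of 0 0] by simp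
    next
      case (step c x y)
      then show ?case
        by (simp add: that(2) distrib_left lin_add[OF \<nu>] lin_add[OF that(1)] lin_scale[OF \<nu>] lin_scale[OF that(1)]
            scale_mult_right)
    qed
  qed
  have T_coeff: "\<rho>' b = \<nu> (a * b)"
    if "lin sc (*) \<rho>'" "T a = (\<Sum>b\<in>B. sc (\<rho>' b) b)" "b \<in> A" for \<rho>' :: "'h \<Rightarrow> 'k" and a b
  proof (rule \<nu>_span[OF that(1) _ that(3)])
    fix b assume b: "b \<in> B"
    have "(\<Sum>b\<in>B. sc (\<rho>' b - \<nu> (a * b)) b) = 0"
      using that(2) by (simp add: T_def scale_left_diff_distrib sum_subtractf)
    then show "\<rho>' b = \<nu> (a * b)"
      using independentD[OF B(2) finB order_refl, of "\<lambda>b. \<rho>' b - \<nu> (a * b)"] b by simp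
  qed
  have "inj_on T A"
  proof (rule inj_onI)
    fix x y assume xy: "x \<in> A" "y \<in> A" "T x = T y"
    have "\<nu> (x * b) = \<nu> (y * b)" if "b \<in> A" for b
      using T_coeff[OF lin_comp[OF \<nu> lin_const_mult[OF lin_id, of x]], of y b] xy(3) that by (simp add: T_def)
    moreover have "\<nu> ((x - y) * b) + \<nu> (y * b) = \<nu> (x * b)" for b
      by (simp only: lin_add[OF \<nu>, symmetric] distrib_right[symmetric] diff_add_cancel)
    ultimately have "\<nu> ((x - y) * b) = 0" if "b \<in> A" for b using that by (metis add_cancel_left_left)
    then show "x = y" using f subspace_diff[OF subspace_A xy(1,2)] by (auto simp: faithful_def)
  qed
  then have inj: "inj_on T (span B)" using sB by simp
  then have iT: "independent (T ` B)"
    using pair.linear_independent_injective_image[OF linear_lin[OF linT] B(2)] by blast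
  have TA: "T a \<in> A" for a
    unfolding T_def using subspace_A B(1) by (auto intro!: subspace_sum subspace_scale)
  have cT: "card (T ` B) = card B" using inj B(1) sB by (metis card_image inj_on_subset)
  have "u \<in> span (T ` B)" if u: "u \<in> A" for u
  proof (rule ccontr)
    assume n: "u \<notin> span (T ` B)"
    then have "independent (insert u (T ` B))" using iT independent_insertI by blast
    moreover have "insert u (T ` B) \<subseteq> span B" using u TA sB by auto
    ultimately have "card (insert u (T ` B)) \<le> card B" using independent_span_bound[OF finB] by blast
    moreover have "u \<notin> T ` B" using n span_base by blast
    ultimately show False using finB cT by simp
  qed
  \<comment> \<open>This vector encodes \<rho>; a preimage under \<open>T\<close> is the element
    sought.\<close>
  moreover have "(\<Sum>b\<in>B. sc (\<rho> b) b) \<in> A"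
    using subspace_A B(1) by (auto intro!: subspace_sum subspace_scale)
  ultimately have "(\<Sum>b\<in>B. sc (\<rho> b) b) \<in> T ` A"
    using pair.linear_span_image[OF linear_lin[OF linT], of B] sB by auto
  then obtain a where "a \<in> A" "T a = (\<Sum>b\<in>B. sc (\<rho> b) b)" by auto
  with T_coeff[OF \<rho>] that show ?thesis by blast
qed

section \<open>Slices, representatives and cointegrals extended to H\<close>

lemma dual_slice:
  assumes "lin sc (*) \<mu>" "lin sc (*) \<nu>"
  shows "\<mu> (tsum (\<lambda>x y. sc (\<nu> y) x) (D a)) = \<nu> (tsum (\<lambda>x y. sc (\<mu> x) y) (D a))"
  by (simp add: lin_tsum[OF assms(1)] lin_tsum[OF assms(2)] lin_scale[OF assms(1)] lin_scale[OF assms(2)] mult.commute)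

text \<open>Any \<mu> applied to the slice equals \<nu> applied to
  \<open>(\<mu> \<otimes> id)\<Delta>(a)\<close>, which lies in \<open>A\<close>; hence only the
  values of \<nu> on \<open>A\<close> count.\<close>

lemma slice_cong:
  assumes "a \<in> A" "lin sc (*) \<nu>" "lin sc (*) \<rho>" "\<And>b. b \<in> A \<Longrightarrow> \<nu> b = \<rho> b"
  shows "tsum (\<lambda>x y. sc (\<nu> y) x) (D a) = tsum (\<lambda>x y. sc (\<rho> y) x) (D a)"
  using assms A_coideal by (intro eq_by_duals) (simp add: dual_slice)

lemma slice_right_cong:
  assumes "lin sc (*) \<nu>" "tensor_eq sc t u"
  shows "tsum (\<lambda>x y. sc (\<nu> y) x) t = tsum (\<lambda>x y. sc (\<nu> y) x) u"
  using assms by (intro tensor_eq_bilin[OF vector_space_axioms]) (auto intro!: lin_intros)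

text \<open>\<open>cointegral\<close> speaks of representatives with right factors in
  \<open>A\<close>, and the list \<open>D a\<close> itself may not be one. Expanding its left legs
  in coordinates gives the sum of \<open>b\<close> \<otimes>
  \<open>(d b \<otimes> id)\<Delta>(a)\<close>, whose right factors lie in \<open>A\<close>.\<close>

lemma tensor_rep_in_A:
  assumes "a \<in> A"
  obtains t where "tensor_eq sc t (D a)" "set (map snd t) \<subseteq> A"
proof -
  obtain F d where F: "finite F" "\<And>b. lin sc (*) (d b)"
    "\<And>x. x \<in> fst ` set (D a) \<Longrightarrow> x = (\<Sum>b\<in>F. sc (d b x) b)"
    by (rule finite_dual_basis[of "fst ` set (D a)"]) auto
  obtain l where l: "set l = F" "distinct l" using F(1) finite_distinct_list by blast
  define t where "t = map (\<lambda>b. (b, tsum (\<lambda>x y. sc (d b x) y) (D a))) l"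
  have "tensor_eq sc t (D a)"
    unfolding tensor_eq_iff
  proof (intro allI impI)
    fix \<mu> \<nu> :: "'h \<Rightarrow> 'k" assume m: "lin sc (*) \<mu>" "lin sc (*) \<nu>"
    have "tsum (\<lambda>x y. \<mu> x * \<nu> y) t = (\<Sum>b\<in>F. \<mu> b * \<nu> (tsum (\<lambda>x y. sc (d b x) y) (D a)))"
      unfolding t_def tsum_def using l by (simp add: comp_def sum_list_distinct_conv_sum_set)
    also have "\<dots> = tsum (\<lambda>x y. \<Sum>b\<in>F. d b x * \<mu> b * \<nu> y) (D a)"
      by (simp add: lin_tsum[OF m(2)] lin_scale[OF m(2)] tsum_sum mult_ac tsum_mult_left[symmetric])
    also have "\<dots> = tsum (\<lambda>x y. \<mu> x * \<nu> y) (D a)"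
    proof (rule tsum_cong)
      fix x y assume "(x, y) \<in> set (D a)"
      then have "x \<in> fst ` set (D a)" by force
      then have "\<mu> x = \<mu> (\<Sum>b\<in>F. sc (d b x) b)" by (rule arg_cong[OF F(3)])
      also have "\<dots> = (\<Sum>b\<in>F. d b x * \<mu> b)" by (simp only: lin_sum[OF m(1)] lin_scale[OF m(1)])
      finally show "(\<Sum>b\<in>F. d b x * \<mu> b * \<nu> y) = \<mu> x * \<nu> y" by (simp only: sum_distrib_right)
    qed
    finally show "tsum (\<lambda>x y. \<mu> x * \<nu> y) t = tsum (\<lambda>x y. \<mu> x * \<nu> y) (D a)" .
  qed
  moreover have "set (map snd t) \<subseteq> A" unfolding t_def using A_coideal[OF assms F(2)] by auto
  ultimately show ?thesis using that by blast
qed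

lemma cointegral_extension:
  assumes "cointegral sc D A g \<phi>"
  obtains \<nu> where "lin sc (*) \<nu>" "\<And>a. a \<in> A \<Longrightarrow> \<nu> a = \<phi> a"
    "\<And>a. a \<in> A \<Longrightarrow> tsum (\<lambda>x y. sc (\<nu> y) x) (D a) = sc (\<nu> a) g"
proof -
  obtain \<nu> where \<nu>: "lin sc (*) \<nu>" "\<And>a. a \<in> A \<Longrightarrow> \<nu> a = \<phi> a"
    using dual_extension[OF subspace_A, of \<phi>] assms by (auto simp: cointegral_def lin_on_def)
  have "tsum (\<lambda>x y. sc (\<nu> y) x) (D a) = sc (\<nu> a) g" if a: "a \<in> A" for a
  proof -
    obtain t where t: "tensor_eq sc t (D a)" "set (map snd t) \<subseteq> A" using tensor_rep_in_A[OF a] .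
    have "tsum (\<lambda>x y. sc (\<nu> y) x) (D a) = tsum (\<lambda>x y. sc (\<nu> y) x) t"
      using slice_right_cong[OF \<nu>(1) t(1)] by simp
    also have "\<dots> = tsum (\<lambda>x y. sc (\<phi> y) x) t"
      using t(2) by (intro tsum_cong arg_cong2[of _ _ _ _ sc] refl \<nu>(2)) force
    also have "\<dots> = sc (\<nu> a) g"
      using assms a t \<nu>(2) by (simp add: cointegral_def slice_right_tsum)
    finally show ?thesis .
  qed
  with \<nu> that show ?thesis by blast
qed

lemma cointegralI:
  assumes "lin sc (*) \<nu>" "\<And>a. a \<in> A \<Longrightarrow> tsum (\<lambda>x y. sc (\<nu> y) x) (D a) = sc (\<nu> a) g"
  shows "cointegral sc D A g \<nu>"
  using assms slice_right_cong[OF assms(1)]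
  by (auto simp: cointegral_def lin_on_def lin_def slice_right_tsum)

end

section \<open>Faithful cointegrals\<close>

locale integral_group_like = integral sc D e S \<Lambda>
  for sc :: "'k::field \<Rightarrow> 'h::ring_1 \<Rightarrow> 'h"
    and D :: "'h \<Rightarrow> 'h tens" and e :: "'h \<Rightarrow> 'k" and S :: "'h \<Rightarrow> 'h" and \<Lambda> :: 'h +
  fixes g :: 'h
  assumes group_like: "group_like sc D g"
begin

lemma D_g: "vector_space s \<Longrightarrow> bilin sc s B \<Longrightarrow> tsum B (D g) = B g g"
  using tensor_eq_bilin[of s B "D g" "[(g, g)]"] group_like by (simp add: group_like_def)

lemma e_g: "e g = 1"
proof -
  have "tsum (\<lambda>x y. sc (e x) y) (D g) = sc (e g) g"
    by (rule D_g[OF vector_space_axioms]) (intro lin_intros)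
  then have "sc (e g) g = sc 1 g" by (simp add: counit_left)
  then show ?thesis using group_like unfolding group_like_def scale_cancel_right by simp
qed

lemma g_S_g: "g * S g = 1"
proof -
  have "tsum (\<lambda>x y. x * S y) (D g) = g * S g"
    by (rule D_g[OF vector_space_axioms]) (intro lin_intros)
  then show ?thesis by (simp add: antipode_right e_g)
qed

text \<open>\<open>S g\<close> is a right inverse of \<open>g\<close>, and \<open>S\<close> is
  injective.\<close>

lemma S_mult_g_cancel: "S a * g = S b * g \<longleftrightarrow> a = b"
proof
  assume "S a * g = S b * g"
  then have "S a * (g * S g) = S b * (g * S g)" by (simp only: mult.assoc[symmetric])
  then show "a = b" using bij_S by (simp add: g_S_g bij_is_inj inj_eq)
qed simp

section \<open>The left leg of \<Delta>(\<Lambda>) and faithful cointegrals\<close>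

lemma in_V_ofI: "lin sc (*) \<nu> \<Longrightarrow> tsum (\<lambda>x y. sc (\<nu> y) x) (D \<Lambda>) \<in> V_of sc D \<Lambda>"
  unfolding V_of_def slice_right_tsum[symmetric] dual_lin_iff by blast

lemma in_V_ofE:
  assumes "v \<in> V_of sc D \<Lambda>"
  obtains \<nu> where "lin sc (*) \<nu>" "v = tsum (\<lambda>x y. sc (\<nu> y) x) (D \<Lambda>)"
  using assms unfolding V_of_def slice_right_tsum[symmetric] dual_lin_iff by blast

lemma \<Lambda>_in_V: "\<Lambda> \<in> V_of sc D \<Lambda>"
  using in_V_ofI[OF lin_e] by (simp only: counit_right)

text \<open>The slice of \<Delta>(\<Lambda>) by \<nu>(a\<cdot>) is \<nu>(\<Lambda>)S(a)g, and by
  faithfulness these functionals exhaust the dual of \<open>A\<close>. If \<nu>(\<Lambda>) were 0,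
  every slice would vanish, including the counit slice \<Lambda>.\<close>

lemma cointegral_imp_V:
  assumes \<nu>: "lin sc (*) \<nu>" "faithful A \<nu>"
    and c: "\<And>a. a \<in> A \<Longrightarrow> tsum (\<lambda>x y. sc (\<nu> y) x) (D a) = sc (\<nu> a) g"
  shows "\<nu> \<Lambda> \<noteq> 0" "V_of sc D \<Lambda> = (\<lambda>a. S a * g) ` A"
proof -
  have slice: "tsum (\<lambda>x y. sc (\<nu> (a * y)) x) (D \<Lambda>) = S (sc (\<nu> \<Lambda>) a) * g" if "a \<in> A" for a
    using slice_mult[OF that \<nu>(1)] c[OF \<Lambda>_in_A]
    by (simp add: lin_scale[OF lin_S] scale_mult_left scale_mult_right)
  have V1: "\<exists>a\<in>A. v = S (sc (\<nu> \<Lambda>) a) * g" if v: "v \<in> V_of sc D \<Lambda>" for v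
  proof -
    obtain \<rho> where \<rho>: "lin sc (*) \<rho>" "v = tsum (\<lambda>x y. sc (\<rho> y) x) (D \<Lambda>)"
      using in_V_ofE[OF v] .
    obtain a where a: "a \<in> A" "\<And>b. b \<in> A \<Longrightarrow> \<rho> b = \<nu> (a * b)"
      using faithful_functional_represents_dual[OF \<nu> \<rho>(1)] by blast
    have "v = tsum (\<lambda>x y. sc (\<nu> (a * y)) x) (D \<Lambda>)"
      unfolding \<rho>(2) by (intro slice_cong \<Lambda>_in_A \<rho>(1) a lin_intros lin_comp[OF \<nu>(1)])
    then show ?thesis using slice a(1) by auto
  qed
  show nz: "\<nu> \<Lambda> \<noteq> 0"
    using V1[OF \<Lambda>_in_V] \<Lambda>_nonzero lin_scale[OF lin_S, of 0 0] by auto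
  have V2: "S a * g \<in> V_of sc D \<Lambda>" if "a \<in> A" for a
  proof -
    have "sc (inverse (\<nu> \<Lambda>)) a \<in> A" using that subspace_A subspace_scale by blast
    from slice[OF this] nz have "tsum (\<lambda>x y. sc (\<nu> (sc (inverse (\<nu> \<Lambda>)) a * y)) x) (D \<Lambda>) = S a * g" by simp
    moreover have "lin sc (*) (\<lambda>y. \<nu> (sc (inverse (\<nu> \<Lambda>)) a * y))" by (intro lin_intros lin_comp[OF \<nu>(1)])
    ultimately show ?thesis using in_V_ofI by metis
  qed
  show "V_of sc D \<Lambda> = (\<lambda>a. S a * g) ` A"
    using V1 V2 subspace_scale[OF subspace_A] by blast
qed

lemma V_imp_cointegral:
  assumes V: "V_of sc D \<Lambda> = (\<lambda>a. S a * g) ` A"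
  obtains \<nu> where "lin sc (*) \<nu>" "faithful A \<nu>"
    "\<And>a. a \<in> A \<Longrightarrow> tsum (\<lambda>x y. sc (\<nu> y) x) (D a) = sc (\<nu> a) g"
proof -
  \<comment> \<open>The candidate cointegral is a functional whose slice of \<Delta>(\<Lambda>) is
    \<open>g\<close> = S(1)g.\<close>
  have "S 1 * g \<in> V_of sc D \<Lambda>" using V one_in_A by blast
  then obtain \<nu> where \<nu>: "lin sc (*) \<nu>" "tsum (\<lambda>x y. sc (\<nu> y) x) (D \<Lambda>) = g"
    using in_V_ofE by (metis S_one mult_1_left)
  have slice: "tsum (\<lambda>x y. sc (\<nu> (a * y)) x) (D \<Lambda>) = S a * g" if "a \<in> A" for a
    using slice_mult[OF that \<nu>(1)] \<nu>(2) by simp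
  have l0: "lin sc (*) (\<lambda>_. 0 :: 'k)" by (simp add: lin_def)
  have f: "faithful A \<nu>"
    unfolding faithful_def
  proof (intro ballI impI)
    fix a assume a: "a \<in> A" "\<forall>b\<in>A. \<nu> (a * b) = 0"
    have "tsum (\<lambda>x y. sc (\<nu> (a * y)) x) (D \<Lambda>) = tsum (\<lambda>x y. sc 0 x) (D \<Lambda>)"
      using a(2) by (intro slice_cong \<Lambda>_in_A lin_intros lin_comp[OF \<nu>(1)] l0) auto
    then have "S a * g = S 0 * g" using slice[OF a(1)] lin_scale[OF lin_S, of 0 0] by simp
    then show "a = 0" by (simp only: S_mult_g_cancel)
  qed
  \<comment> \<open>\<open>W\<close> is the right leg of \<Delta>(\<Lambda>); the cointegral
    identity can be checked on it by coassociativity.\<close>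
  define w where "w \<mu> = tsum (\<lambda>x y. sc (\<mu> x) y) (D \<Lambda>)" for \<mu>
  define W where "W = {w \<mu> | \<mu>. lin sc (*) \<mu>}"
  have W_subspace: "subspace W"
    unfolding subspace_def
  proof (intro conjI ballI allI)
    have "w (\<lambda>_. 0) = 0" by (simp add: w_def)
    then show "0 \<in> W" unfolding W_def using l0 by force
  next
    fix x y assume "x \<in> W" "y \<in> W"
    then obtain \<mu> \<rho> where m: "lin sc (*) \<mu>" "x = w \<mu>" "lin sc (*) \<rho>" "y = w \<rho>" unfolding W_def by blast
    have "x + y = w (\<lambda>x. \<mu> x + \<rho> x)" by (simp add: m w_def scale_left_distrib tsum_add)
    moreover have "lin sc (*) (\<lambda>x. \<mu> x + \<rho> x)" using m by (simp add: lin_def distrib_left)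
    ultimately show "x + y \<in> W" unfolding W_def by blast
  next
    fix c x assume "x \<in> W"
    then obtain \<mu> where m: "lin sc (*) \<mu>" "x = w \<mu>" unfolding W_def by blast
    have "sc c x = w (\<lambda>x. c * \<mu> x)"
      by (simp only: m w_def scale_scale[symmetric] tsum_scale_right[OF vector_space_axioms])
    moreover have "lin sc (*) (\<lambda>x. c * \<mu> x)" using m(1) by (rule lin_const_mult_field)
    ultimately show "sc c x \<in> W" unfolding W_def by blast
  qed
  \<comment> \<open>Otherwise some \<rho> vanishes on \<open>W\<close> with \<rho>(a) = 1. On
    \<open>A\<close> it equals \<nu>(c\<cdot>), so its slice is S(c)g; but that slice is 0 because
    \<rho> kills the right leg. Hence c = 0, contradicting \<rho>(a) = 1.\<close>
  have W: "a \<in> W" if a: "a \<in> A" for a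
  proof (rule ccontr)
    assume "a \<notin> W"
    then obtain \<rho> where \<rho>: "lin sc (*) \<rho>" "\<And>w. w \<in> W \<Longrightarrow> \<rho> w = 0" "\<rho> a = 1"
      using separate_subspace[OF W_subspace] by blast
    obtain c where c: "c \<in> A" "\<And>b. b \<in> A \<Longrightarrow> \<rho> b = \<nu> (c * b)"
      using faithful_functional_represents_dual[OF \<nu>(1) f \<rho>(1)] by blast
    have "S c * g = tsum (\<lambda>x y. sc (\<rho> y) x) (D \<Lambda>)"
      unfolding slice[OF c(1), symmetric]
      using c(2) by (intro slice_cong \<Lambda>_in_A \<rho>(1) lin_intros lin_comp[OF \<nu>(1)]) auto
    also have "\<dots> = 0"
    proof (rule eq_by_duals)
      fix \<mu> :: "'h \<Rightarrow> 'k" assume l: "lin sc (*) \<mu>"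
      then have "w \<mu> \<in> W" unfolding W_def by blast
      then show "\<mu> (tsum (\<lambda>x y. sc (\<rho> y) x) (D \<Lambda>)) = \<mu> 0"
        using dual_slice[OF l \<rho>(1), of \<Lambda>] \<rho>(2)[of "w \<mu>"] lin_scale[OF l, of 0 0] by (simp add: w_def)
    qed
    finally have "S c * g = S 0 * g" using lin_scale[OF lin_S, of 0 0] by simp
    then have "c = 0" by (simp only: S_mult_g_cancel)
    then show False using c(2)[OF a] \<rho>(3) lin_scale[OF \<nu>(1), of 0 0] by simp
  qed
  \<comment> \<open>With \<open>a = \<mu>(\<Lambda>\<^sub>1)\<Lambda>\<^sub>2\<close>, the slice
    \<open>a\<^sub>1\<nu>(a\<^sub>2)\<close> becomes (\<mu> \<otimes> id)\<Delta>(g) = \<mu>(g)g,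
    and \<mu>(g) = \<nu>(a).\<close>
  have "tsum (\<lambda>x y. sc (\<nu> y) x) (D a) = sc (\<nu> a) g" if a: "a \<in> A" for a
  proof -
    obtain \<mu> where \<mu>: "lin sc (*) \<mu>" "a = tsum (\<lambda>x y. sc (\<mu> x) y) (D \<Lambda>)"
      using W[OF a] unfolding W_def w_def[symmetric] by blast
    note li = lin_intros \<nu>(1) \<mu>(1)
    have lD: "lin sc sc (\<lambda>z. tsum (\<lambda>x y. sc (\<nu> y) x) (D z))" "lin sc sc (\<lambda>z. tsum (\<lambda>x y. sc (\<mu> x) y) (D z))"
      by (intro li)+
    have "tsum (\<lambda>x y. sc (\<nu> y) x) (D a)
      = tsum (\<lambda>x y. tsum (\<lambda>u v. sc (\<mu> x) (sc (\<nu> v) u)) (D y)) (D \<Lambda>)"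
      by (simp only: \<mu>(2) lin_tsum[OF lD(1)] lin_scale[OF lD(1)] tsum_scale_right[OF vector_space_axioms])
    also have "\<dots> = tsum (\<lambda>x y. tsum (\<lambda>u v. sc (\<mu> u) (sc (\<nu> y) v)) (D x)) (D \<Lambda>)"
      by (rule coassoc[OF vector_space_axioms, symmetric]) (intro li)
    also have "\<dots> = tsum (\<lambda>x y. sc (\<nu> y) (tsum (\<lambda>u v. sc (\<mu> u) v) (D x))) (D \<Lambda>)"
      by (simp only: tsum_scale_right[OF vector_space_axioms, symmetric] scale_left_commute)
    also have "\<dots> = tsum (\<lambda>x y. sc (\<mu> x) y) (D (tsum (\<lambda>x y. sc (\<nu> y) x) (D \<Lambda>)))"
      by (simp only: lin_tsum[OF lD(2)] lin_scale[OF lD(2)])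
    also have "\<dots> = sc (\<mu> g) g"
      unfolding \<nu>(2) by (rule D_g[OF vector_space_axioms]) (intro li)
    also have "\<mu> g = \<nu> a"
      using dual_slice[OF \<mu>(1) \<nu>(1), of \<Lambda>] unfolding \<nu>(2) \<mu>(2) .
    finally show ?thesis .
  qed
  with \<nu>(1) f that show ?thesis by blast
qed

section \<open>The identity for (1 \<otimes> \<Lambda>)\<Delta>(\<Lambda>) and the spaces of
  integrals\<close>

lemma \<Lambda>_mult_D_\<Lambda>:
  assumes V: "V_of sc D \<Lambda> = (\<lambda>a. S a * g) ` A"
  shows "tensor_eq sc (tmul [(1, \<Lambda>)] (D \<Lambda>)) [(S \<Lambda> * g, \<Lambda>)]"
  unfolding tensor_eq_iff
proof (intro allI impI)
  fix \<mu> \<nu> :: "'h \<Rightarrow> 'k" assume l: "lin sc (*) \<mu>" "lin sc (*) \<nu>"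
  let ?v = "tsum (\<lambda>x y. sc (\<nu> y) x) (D \<Lambda>)"
  have "?v \<in> V_of sc D \<Lambda>" by (rule in_V_ofI[OF l(2)])
  then obtain a where a: "a \<in> A" "?v = S a * g" using V by blast
  \<comment> \<open>Since \<open>S\<close> and \<open>g\<close> are invisible to the counit, it
    determines the scalar e(a) although \<open>a\<close> comes only from the hypothesis on the left
    leg.\<close>
  have "e a = e ?v" by (simp add: a(2) e_mult e_S e_g)
  also have "\<dots> = \<nu> \<Lambda>" by (simp only: dual_slice[OF lin_e l(2)] counit_left)
  finally have ea: "e a = \<nu> \<Lambda>" .
  have "S \<Lambda> * ?v = S (a * \<Lambda>) * g" by (simp add: a(2) S_mult mult.assoc)
  also have "\<dots> = sc (\<nu> \<Lambda>) (S \<Lambda> * g)"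
    by (simp add: A_mult_\<Lambda>[OF a(1)] lin_scale[OF lin_S] scale_mult_left ea)
  finally have Sv: "S \<Lambda> * ?v = sc (\<nu> \<Lambda>) (S \<Lambda> * g)" .
  have "tsum (\<lambda>x y. \<mu> x * \<nu> y) (tmul [(1, \<Lambda>)] (D \<Lambda>)) = \<mu> (tsum (\<lambda>x y. sc (\<nu> (\<Lambda> * y)) x) (D \<Lambda>))"
    by (simp add: tsum_tmul lin_tsum[OF l(1)] lin_scale[OF l(1)] mult.commute)
  also have "\<dots> = \<nu> \<Lambda> * \<mu> (S \<Lambda> * g)"
    by (simp only: slice_mult[OF \<Lambda>_in_A l(2)] Sv lin_scale[OF l(1)])
  finally show "tsum (\<lambda>x y. \<mu> x * \<nu> y) (tmul [(1, \<Lambda>)] (D \<Lambda>)) = tsum (\<lambda>x y. \<mu> x * \<nu> y) [(S \<Lambda> * g, \<Lambda>)]"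
    by (simp add: mult.commute)
qed

text \<open>If \<rho> = \<nu>(a\<cdot>) on \<open>A\<close>, then \<rho>(x) = e(a)\<nu>(x) for every
  left integral x, and likewise \<rho>(\<Lambda>) = e(a)\<nu>(\<Lambda>). All functionals therefore
  see x as \<nu>(x)/\<nu>(\<Lambda>) times \<Lambda>.\<close>

lemma L_eps_eq:
  assumes "lin sc (*) \<nu>" "faithful A \<nu>" "\<nu> \<Lambda> \<noteq> 0"
  shows "L_eps sc e A = range (\<lambda>c. sc c \<Lambda>)"
proof
  show "range (\<lambda>c. sc c \<Lambda>) \<subseteq> L_eps sc e A"
    using \<Lambda>_in_A subspace_scale[OF subspace_A]
    by (auto simp: L_eps_def A_mult_\<Lambda> scale_mult_right mult.commute)
  show "L_eps sc e A \<subseteq> range (\<lambda>c. sc c \<Lambda>)"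
  proof
    fix x assume "x \<in> L_eps sc e A"
    then have x: "x \<in> A" "\<And>a. a \<in> A \<Longrightarrow> a * x = sc (e a) x" by (auto simp: L_eps_def)
    have "x = sc (\<nu> x / \<nu> \<Lambda>) \<Lambda>"
    proof (rule eq_by_duals)
      fix \<rho> :: "'h \<Rightarrow> 'k" assume \<rho>: "lin sc (*) \<rho>"
      obtain a where a: "a \<in> A" "\<And>b. b \<in> A \<Longrightarrow> \<rho> b = \<nu> (a * b)"
        using faithful_functional_represents_dual[OF assms(1,2) \<rho>] by blast
      show "\<rho> x = \<rho> (sc (\<nu> x / \<nu> \<Lambda>) \<Lambda>)"
        using a(2)[OF x(1)] a(2)[OF \<Lambda>_in_A] x(2)[OF a(1)] A_mult_\<Lambda>[OF a(1)] assms(3)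
        by (simp add: lin_scale[OF \<rho>] lin_scale[OF assms(1)])
    qed
    then show "x \<in> range (\<lambda>c. sc c \<Lambda>)" by blast
  qed
qed

text \<open>For a right integral x, \<nu>(xa) = e(a)\<nu>(x), so by faithfulness \<nu> is injective
  on the space of right integrals.\<close>

lemma R_eps_eq:
  assumes \<nu>: "lin sc (*) \<nu>" "faithful A \<nu>" and r: "r \<in> R_eps sc e A" "r \<noteq> 0"
  shows "R_eps sc e A = range (\<lambda>c. sc c r)"
proof
  have rA: "r \<in> A" "\<And>a. a \<in> A \<Longrightarrow> r * a = sc (e a) r" using r(1) by (auto simp: R_eps_def)
  have nz: "\<nu> r \<noteq> 0"
    using \<nu>(2) rA r(2) by (auto simp: faithful_def lin_scale[OF \<nu>(1)])
  show "range (\<lambda>c. sc c r) \<subseteq> R_eps sc e A"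
    using rA subspace_scale[OF subspace_A] by (auto simp: R_eps_def scale_mult_left mult.commute)
  show "R_eps sc e A \<subseteq> range (\<lambda>c. sc c r)"
  proof
    fix x assume "x \<in> R_eps sc e A"
    then have x: "x \<in> A" "\<And>a. a \<in> A \<Longrightarrow> x * a = sc (e a) x" by (auto simp: R_eps_def)
    \<comment> \<open>The coefficient is chosen so that this right integral has \<nu>-value
      0.\<close>
    let ?y = "x + sc (- (\<nu> x / \<nu> r)) r"
    have "?y \<in> A" using x(1) rA(1) subspace_A by (simp only: subspace_add subspace_scale)
    moreover have "\<nu> (?y * a) = 0" if "a \<in> A" for a
      using x(2)[OF that] rA(2)[OF that] nz
      by (simp only: distrib_right scale_mult_left lin_add[OF \<nu>(1)] lin_scale[OF \<nu>(1)]) (simp add: field_simps)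
    ultimately have "?y = 0" using \<nu>(2) by (auto simp: faithful_def)
    then have "x = sc (\<nu> x / \<nu> r) r" by (simp add: eq_neg_iff_add_eq_0)
    then show "x \<in> range (\<lambda>c. sc c r)" by blast
  qed
qed

text \<open>If \<Lambda> is a right integral, then (1 \<otimes> \<Lambda>)\<Delta>(\<Lambda>) also
  equals \<Lambda> \<otimes> \<Lambda>, and comparison with S(\<Lambda>)g \<otimes> \<Lambda> gives
  the equation. Conversely the equation turns S(\<Lambda>a)g into S(a)\<Lambda>, a multiple of
  \<Lambda> = S(\<Lambda>)g, and S(\<cdot>)g is cancelled.\<close>

lemma L_eps_eq_R_eps_iff:
  assumes \<nu>: "lin sc (*) \<nu>" "faithful A \<nu>" "\<nu> \<Lambda> \<noteq> 0" and V: "V_of sc D \<Lambda> = (\<lambda>a. S a * g) ` A"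
  shows "L_eps sc e A = R_eps sc e A \<longleftrightarrow> \<Lambda> = S \<Lambda> * g"
proof
  assume "L_eps sc e A = R_eps sc e A"
  then have "\<Lambda> \<in> R_eps sc e A" using \<Lambda>_in_A A_mult_\<Lambda> by (auto simp: L_eps_def)
  then have R: "\<Lambda> * a = sc (e a) \<Lambda>" if "a \<in> A" for a using that by (auto simp: R_eps_def)
  show "\<Lambda> = S \<Lambda> * g"
  proof (rule eq_by_duals)
    fix \<mu> :: "'h \<Rightarrow> 'k" assume \<mu>: "lin sc (*) \<mu>"
    let ?w = "tsum (\<lambda>x y. sc (\<mu> x) y) (D \<Lambda>)"
    have "?w \<in> A" by (rule A_coideal[OF \<Lambda>_in_A \<mu>])
    then have "\<Lambda> * ?w = sc (e ?w) \<Lambda>" by (rule R)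
    moreover have "e ?w = \<mu> \<Lambda>" by (simp only: dual_slice[OF \<mu> lin_e, symmetric] counit_right)
    moreover have "\<nu> (\<Lambda> * ?w) = tsum (\<lambda>x y. \<mu> x * \<nu> y) (tmul [(1, \<Lambda>)] (D \<Lambda>))"
      by (simp only: tsum_tmul tsum_Cons tsum_Nil fst_conv snd_conv mult_1_left add_0_right
          tsum_mult_left[symmetric] scale_mult_right lin_tsum[OF \<nu>(1)] lin_scale[OF \<nu>(1)])
    moreover have "\<dots> = \<mu> (S \<Lambda> * g) * \<nu> \<Lambda>"
      using \<Lambda>_mult_D_\<Lambda>[OF V] \<mu> \<nu>(1) unfolding tensor_eq_iff by simp
    ultimately have "\<mu> \<Lambda> * \<nu> \<Lambda> = \<mu> (S \<Lambda> * g) * \<nu> \<Lambda>" by (simp add: lin_scale[OF \<nu>(1)])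
    then show "\<mu> \<Lambda> = \<mu> (S \<Lambda> * g)" using \<nu>(3) by simp
  qed
next
  assume eq: "\<Lambda> = S \<Lambda> * g"
  have "\<Lambda> \<in> R_eps sc e A"
    unfolding R_eps_def
  proof (intro CollectI conjI ballI \<Lambda>_in_A)
    fix a assume a: "a \<in> A"
    have "S (\<Lambda> * a) * g = S a * \<Lambda>" by (simp add: S_mult mult.assoc eq[symmetric])
    also have "\<dots> = S (sc (e a) \<Lambda>) * g"
      by (simp add: A_S_mult_\<Lambda>[OF a] lin_scale[OF lin_S] scale_mult_left eq[symmetric])
    finally show "\<Lambda> * a = sc (e a) \<Lambda>" by (simp only: S_mult_g_cancel)
  qed
  then show "L_eps sc e A = R_eps sc e A"
    using L_eps_eq[OF \<nu>] R_eps_eq[OF \<nu>(1,2) _ \<Lambda>_nonzero] by simp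
qed

end

theorem mainTheorem16:
  fixes sc :: "'k::field \<Rightarrow> 'h::ring_1 \<Rightarrow> 'h"
    and D :: "'h \<Rightarrow> 'h tens" and e :: "'h \<Rightarrow> 'k" and S :: "'h \<Rightarrow> 'h"
    and \<Lambda> g :: 'h
  assumes "hopf_algebra sc D e S"
    and "integral_type sc D \<Lambda>"
    and "group_like sc D g"
  shows "((\<exists>\<phi>. cointegral sc D (A_of sc D \<Lambda>) g \<phi> \<and> faithful (A_of sc D \<Lambda>) \<phi>)
           \<longleftrightarrow> V_of sc D \<Lambda> = (\<lambda>a. S a * g) ` A_of sc D \<Lambda>)
     \<and> ((\<exists>\<phi>. cointegral sc D (A_of sc D \<Lambda>) g \<phi> \<and> faithful (A_of sc D \<Lambda>) \<phi>
              \<and> (\<exists>a\<in>A_of sc D \<Lambda>. \<phi> a \<noteq> 0))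
         \<longrightarrow> tensor_eq sc (tmul [(1, \<Lambda>)] (D \<Lambda>)) [(S \<Lambda> * g, \<Lambda>)]
             \<and> (L_eps sc e (A_of sc D \<Lambda>) = R_eps sc e (A_of sc D \<Lambda>) \<longleftrightarrow> \<Lambda> = S \<Lambda> * g))"
proof -
  interpret integral_group_like sc D e S \<Lambda> g
    using assms by unfold_locales
  have ext: "\<exists>\<nu>. lin sc (*) \<nu> \<and> faithful A \<nu> \<and> \<nu> \<Lambda> \<noteq> 0 \<and> V_of sc D \<Lambda> = (\<lambda>a. S a * g) ` A"
    if \<phi>: "cointegral sc D A g \<phi>" "faithful A \<phi>" for \<phi>
  proof -
    obtain \<nu> where \<nu>: "lin sc (*) \<nu>" "\<And>a. a \<in> A \<Longrightarrow> \<nu> a = \<phi> a"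
      "\<And>a. a \<in> A \<Longrightarrow> tsum (\<lambda>x y. sc (\<nu> y) x) (D a) = sc (\<nu> a) g"
      using cointegral_extension[OF \<phi>(1)] by blast
    \<comment> \<open>\<phi> and its extension agree on all products of elements of
      \<open>A\<close>, because \<open>A\<close> is closed under multiplication.\<close>
    have f: "faithful A \<nu>" using \<phi>(2) \<nu>(2) A_mult by (simp add: faithful_def)
    show ?thesis using \<nu>(1) f cointegral_imp_V[OF \<nu>(1) f \<nu>(3)] by blast
  qed
  have "\<exists>\<phi>. cointegral sc D A g \<phi> \<and> faithful A \<phi>" if "V_of sc D \<Lambda> = (\<lambda>a. S a * g) ` A"
    using V_imp_cointegral[OF that] cointegralI by metis
  then show ?thesis using ext \<Lambda>_mult_D_\<Lambda> L_eps_eq_R_eps_iff by blast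
qed

end
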